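(* Let $\Bbbk$ be a commutative ring with unit, let $\mathcal{P}$ be a finite pointed lower saturated poset and let $\mathbf{a}=\{a_v\colon M_v\to N_v\mid v\in V_\mathcal{P}\}$ be a collection of morphisms of $\Bbbk$-modules that has a section. Then for each $n>0$, $$\varprojlim_{\mathcal{P}}{}^{n}\,\mathcal{T}_{\mathcal{P},\mathbf{a}}=0 .$$
   Context: A poset $\mathcal{P}$ is regarded as a small category with exactly one morphism $\iota_{x,y}\colon x\to y$ whenever $x\le y$. It is pointed if it has an initial (least) object $*$. A vertex of $\mathcal{P}$ is an object $v\ne *$ such that $y<v$ implies $y=*$. $V_\mathcal{P}$ is the set of vertices, and $V(x)=\{v\in V_\mathcal{P}\mid v\le x\}$ for $x\in\mathcal{P}$. For objects $x,y$, $[x\vee y]$ denotes the set of minimal upper bounds of $\{x,y\}$ and $[x\wedge y]$ the set of maximal lower bounds of $\{x,y\}$. $\mathcal{P}$ is lower saturated if for each pair of objects $x,y$ with $[x\vee y]\ne\emptyset$ there is $w\in[x\wedge y]$ with $V(w)=V(x)\cap V(y)$. A section of $\mathbf{a}$ is a collection of morphisms of $\Bbbk$-modules $\{s_v\colon N_v\to M_v\mid v\in V_\mathcal{P}\}$ with $a_v\circ s_v=1_{N_v}$ for every $v$. The functor $\mathcal{T}_{\mathcal{P},\mathbf{a}}$ from $\mathcal{P}^{\mathrm{op}}$ to $\Bbbk$-modules is given on objects by $\mathcal{T}_{\mathcal{P},\mathbf{a}}(p)=\bigotimes_{v\in V_\mathcal{P}}C_{p,v}$ (tensor product over $\Bbbk$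 indexed by the finite set $V_\mathcal{P}$), where $C_{p,v}=M_v$ if $v\in V(p)$ and $C_{p,v}=N_v$ if $v\notin V(p)$. For $p\le q$, $\mathcal{T}_{\mathcal{P},\mathbf{a}}(\iota_{p,q})\colon\mathcal{T}_{\mathcal{P},\mathbf{a}}(q)\to\mathcal{T}_{\mathcal{P},\mathbf{a}}(p)$ is $\bigotimes_{v}f_v$, where $f_v=1_{M_v}$ if $v\in V(p)$, $f_v=a_v$ if $v\in V(q)\setminus V(p)$, and $f_v=1_{N_v}$ if $v\notin V(q)$. $\varprojlim^n_{\mathcal{P}}$ denotes the $n$-th right derived functor of the inverse limit of functors on $\mathcal{P}^{\mathrm{op}}$. *)

theory Defs
  imports "HOL-Algebra.Module" "HOL-Algebra.AbelCoset"
begin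

section \<open>Posets\<close>

text \<open>A finite pointed poset is a type of class \<open>finite\<close> and \<open>order_bot\<close>.\<close>

definition vertices :: "'p::order_bot set" where
  "vertices = {v. v \<noteq> bot \<and> (\<forall>y. y < v \<longrightarrow> y = bot)}"

definition vertices_below :: "'p::order_bot \<Rightarrow> 'p set" where
  "vertices_below x = {v \<in> vertices. v \<le> x}"

definition minimal_upper_bounds :: "'p::order \<Rightarrow> 'p \<Rightarrow> 'p set" where
  "minimal_upper_bounds x y =
     {z. x \<le> z \<and> y \<le> z \<and> (\<forall>w. x \<le> w \<and> y \<le> w \<and> w \<le> z \<longrightarrow> w = z)}"

definition maximal_lower_bounds :: "'p::order \<Rightarrow> 'p \<Rightarrow> 'p set" where
  "maximal_lower_bounds x y =
     {z. z \<le> x \<and> z \<le> y \<and> (\<forall>w. w \<le> x \<and> w \<le> y \<and> z \<le> w \<longrightarrow> w = z)}"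

definition lower_saturated :: "'p::order_bot itself \<Rightarrow> bool" where
  "lower_saturated _ \<longleftrightarrow>
     (\<forall>x y :: 'p. minimal_upper_bounds x y \<noteq> {} \<longrightarrow>
        (\<exists>w \<in> maximal_lower_bounds x y.
           vertices_below w = vertices_below x \<inter> vertices_below y))"


section \<open>Modules\<close>

text \<open>
  Modules are records that also carry the ring fields \<open>mult\<close> and \<open>one\<close>; the locale
  \<^locale>\<open>module\<close> does not constrain them, and they are left unspecified below.
\<close>

definition module_hom ::
    "('k, 'c) ring_scheme \<Rightarrow> ('k, 'a) module \<Rightarrow> ('k, 'b) module \<Rightarrow> ('a \<Rightarrow> 'b) set" where
  "module_hom R M N =
     {h \<in> carrier M \<rightarrow> carrier N.
        (\<forall>x\<in>carrier M. \<forall>y\<in>carrier M. h (x \<oplus>\<^bsub>M\<^esub> y) = h x \<oplus>\<^bsub>N\<^esub> h y) \<and>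
        (\<forall>r\<in>carrier R. \<forall>x\<in>carrier M. h (r \<odot>\<^bsub>M\<^esub> x) = r \<odot>\<^bsub>N\<^esub> h x)}"

definition submodule_generated ::
    "('k, 'c) ring_scheme \<Rightarrow> ('k, 'a) module \<Rightarrow> 'a set \<Rightarrow> 'a set" where
  "submodule_generated R M S = \<Inter>{H. submodule H R M \<and> S \<subseteq> H}"

definition quotient_module :: "('k, 'a) module \<Rightarrow> 'a set \<Rightarrow> ('k, 'a set) module" where
  "quotient_module M H =
     \<lparr>carrier = a_rcosets\<^bsub>M\<^esub> H, mult = undefined, one = undefined,
      zero = H, add = set_add M, smult = (\<lambda>r X. \<Union>x\<in>X. H +>\<^bsub>M\<^esub> (r \<odot>\<^bsub>M\<^esub> x))\<rparr>"

definition free_module :: "('k, 'c) ring_scheme \<Rightarrow> 'x set \<Rightarrow> ('k, 'x \<Rightarrow> 'k) module" where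
  "free_module R X =
     \<lparr>carrier = {f. f \<in> X \<rightarrow> carrier R \<and> (\<forall>x. x \<notin> X \<longrightarrow> f x = \<zero>\<^bsub>R\<^esub>) \<and> finite {x. f x \<noteq> \<zero>\<^bsub>R\<^esub>}},
      mult = undefined, one = undefined,
      zero = (\<lambda>x. \<zero>\<^bsub>R\<^esub>), add = (\<lambda>f g x. f x \<oplus>\<^bsub>R\<^esub> g x), smult = (\<lambda>r f x. r \<otimes>\<^bsub>R\<^esub> f x)\<rparr>"

definition free_basis :: "('k, 'c) ring_scheme \<Rightarrow> 'x \<Rightarrow> 'x \<Rightarrow> 'k" where
  "free_basis R x = (\<lambda>y. if y = x then \<one>\<^bsub>R\<^esub> else \<zero>\<^bsub>R\<^esub>)"


section \<open>Tensor products over a finite index set\<close>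

definition tuples :: "'v set \<Rightarrow> ('v \<Rightarrow> ('k, 'm) module) \<Rightarrow> ('v \<Rightarrow> 'm) set" where
  "tuples V C = (\<Pi>\<^sub>E v\<in>V. carrier (C v))"

definition tensor_relations ::
    "('k, 'c) ring_scheme \<Rightarrow> 'v set \<Rightarrow> ('v \<Rightarrow> ('k, 'm) module) \<Rightarrow> (('v \<Rightarrow> 'm) \<Rightarrow> 'k) set" where
  "tensor_relations R V C =
     (let F = free_module R (tuples V C); b = free_basis R in
      submodule_generated R F
        ({b (c(v := x \<oplus>\<^bsub>C v\<^esub> y)) \<ominus>\<^bsub>F\<^esub> (b (c(v := x)) \<oplus>\<^bsub>F\<^esub> b (c(v := y))) | c v x y.
            c \<in> tuples V C \<and> v \<in> V \<and> x \<in> carrier (C v) \<and> y \<in> carrier (C v)} \<union>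
         {b (c(v := r \<odot>\<^bsub>C v\<^esub> x)) \<ominus>\<^bsub>F\<^esub> (r \<odot>\<^bsub>F\<^esub> b (c(v := x))) | c v r x.
            c \<in> tuples V C \<and> v \<in> V \<and> r \<in> carrier R \<and> x \<in> carrier (C v)}))"

definition tensor_product ::
    "('k, 'c) ring_scheme \<Rightarrow> 'v set \<Rightarrow> ('v \<Rightarrow> ('k, 'm) module) \<Rightarrow>
     ('k, (('v \<Rightarrow> 'm) \<Rightarrow> 'k) set) module" where
  "tensor_product R V C =
     quotient_module (free_module R (tuples V C)) (tensor_relations R V C)"

text \<open>
  The linear extension of \<open>f\<close>, from the free module on \<open>X\<close>: it sends the basis element at
  \<open>c \<in> X\<close> to the basis element at \<open>f c\<close>.
\<close>

definition free_map ::
    "('k, 'c) ring_scheme \<Rightarrow> 'x set \<Rightarrow> ('x \<Rightarrow> 'y) \<Rightarrow> ('x \<Rightarrow> 'k) \<Rightarrow> 'y \<Rightarrow> 'k" where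
  "free_map R X f x = (\<lambda>d. finsum R x {c \<in> X. x c \<noteq> \<zero>\<^bsub>R\<^esub> \<and> f c = d})"

text \<open>
  The map \<open>\<Otimes>\<^sub>v f v\<close> from the tensor product of \<open>C\<close> to that of \<open>D\<close>: the union below is that of
  the cosets of the images of all representatives, which are all the same coset.
\<close>

definition tensor_map ::
    "('k, 'c) ring_scheme \<Rightarrow> 'v set \<Rightarrow> ('v \<Rightarrow> ('k, 'm) module) \<Rightarrow> ('v \<Rightarrow> ('k, 'm) module) \<Rightarrow>
     ('v \<Rightarrow> 'm \<Rightarrow> 'm) \<Rightarrow> (('v \<Rightarrow> 'm) \<Rightarrow> 'k) set \<Rightarrow> (('v \<Rightarrow> 'm) \<Rightarrow> 'k) set" where
  "tensor_map R V C D f X =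
     (\<Union>x\<in>X. tensor_relations R V D +>\<^bsub>free_module R (tuples V D)\<^esub>
              free_map R (tuples V C) (\<lambda>c. \<lambda>v\<in>V. f v (c v)) x)"


section \<open>Functors on the opposite of a poset, with values in modules\<close>

text \<open>
  For \<open>p \<le> q\<close>, the field \<open>mor F p q\<close> is the map from \<open>obj F q\<close> to \<open>obj F p\<close>; its values for
  other \<open>p, q\<close>, and outside the carrier of \<open>obj F q\<close>, are irrelevant.
\<close>

record ('p, 'k, 'b) poset_functor =
  obj :: "'p \<Rightarrow> ('k, 'b) module"
  mor :: "'p \<Rightarrow> 'p \<Rightarrow> 'b \<Rightarrow> 'b"

definition is_functor ::
    "('k, 'c) ring_scheme \<Rightarrow> ('p::order, 'k, 'b) poset_functor \<Rightarrow> bool" where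
  "is_functor R F \<longleftrightarrow>
     (\<forall>p. module R (obj F p)) \<and>
     (\<forall>p q. p \<le> q \<longrightarrow> mor F p q \<in> module_hom R (obj F q) (obj F p)) \<and>
     (\<forall>p. \<forall>x\<in>carrier (obj F p). mor F p p x = x) \<and>
     (\<forall>p q r. p \<le> q \<longrightarrow> q \<le> r \<longrightarrow>
        (\<forall>x\<in>carrier (obj F r). mor F p q (mor F q r x) = mor F p r x))"

definition nat_trans ::
    "('k, 'c) ring_scheme \<Rightarrow> ('p::order, 'k, 'a) poset_functor \<Rightarrow> ('p, 'k, 'b) poset_functor \<Rightarrow>
     ('p \<Rightarrow> 'a \<Rightarrow> 'b) \<Rightarrow> bool" where
  "nat_trans R F G \<eta> \<longleftrightarrow>
     (\<forall>p. \<eta> p \<in> module_hom R (obj F p) (obj G p)) \<and>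
     (\<forall>p q. p \<le> q \<longrightarrow> (\<forall>x\<in>carrier (obj F q). \<eta> p (mor F p q x) = mor G p q (\<eta> q x)))"

text \<open>
  Monomorphisms of functors with values in modules are the objectwise injective natural
  transformations.
  Quantification over all functors \<open>A\<close>, \<open>B\<close> is not possible in HOL, so they range over all
  functors whose modules have their carriers in \<open>nat \<Rightarrow> 'k\<close>. By Baer's criterion this is no loss:
  it is enough to take for \<open>B\<close> the functors with value \<open>R\<close> at \<open>p \<le> q\<close> and \<open>0\<close> elsewhere, for
  each \<open>q\<close>, which generate the category of functors, and for \<open>A\<close> their subfunctors.
\<close>

definition injective_functor ::
    "('k, 'c) ring_scheme \<Rightarrow> ('p::order, 'k, 'b) poset_functor \<Rightarrow> bool" where
  "injective_functor R I \<longleftrightarrow>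
     is_functor R I \<and>
     (\<forall>(A :: ('p, 'k, nat \<Rightarrow> 'k) poset_functor) (B :: ('p, 'k, nat \<Rightarrow> 'k) poset_functor) i f.
        is_functor R A \<and> is_functor R B \<and>
        nat_trans R A B i \<and> (\<forall>p. inj_on (i p) (carrier (obj A p))) \<and> nat_trans R A I f \<longrightarrow>
        (\<exists>g. nat_trans R B I g \<and> (\<forall>p. \<forall>x\<in>carrier (obj A p). g p (i p x) = f p x)))"

text \<open>An injective resolution \<open>0 \<rightarrow> F \<rightarrow> I 0 \<rightarrow> I 1 \<rightarrow> \<dots>\<close>, with augmentation \<open>e\<close> and differentials \<open>d\<close>.\<close>

definition injective_resolution ::
    "('k, 'c) ring_scheme \<Rightarrow> ('p::order, 'k, 'a) poset_functor \<Rightarrow>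
     (nat \<Rightarrow> ('p, 'k, 'b) poset_functor) \<Rightarrow> (nat \<Rightarrow> 'p \<Rightarrow> 'b \<Rightarrow> 'b) \<Rightarrow> ('p \<Rightarrow> 'a \<Rightarrow> 'b) \<Rightarrow> bool" where
  "injective_resolution R F I d e \<longleftrightarrow>
     (\<forall>n. injective_functor R (I n)) \<and>
     (\<forall>n. nat_trans R (I n) (I (Suc n)) (d n)) \<and>
     nat_trans R F (I 0) e \<and>
     (\<forall>p. inj_on (e p) (carrier (obj F p))) \<and>
     (\<forall>p. e p ` carrier (obj F p) = a_kernel (obj (I 0) p) (obj (I 1) p) (d 0 p)) \<and>
     (\<forall>n p. d n p ` carrier (obj (I n) p) =
        a_kernel (obj (I (Suc n)) p) (obj (I (Suc (Suc n))) p) (d (Suc n) p))"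


section \<open>Inverse limits and their right derived functors\<close>

definition lim_functor :: "('p::order, 'k, 'b) poset_functor \<Rightarrow> ('k, 'p \<Rightarrow> 'b) module" where
  "lim_functor F =
     \<lparr>carrier = {x. (\<forall>p. x p \<in> carrier (obj F p)) \<and> (\<forall>p q. p \<le> q \<longrightarrow> mor F p q (x q) = x p)},
      mult = undefined, one = undefined,
      zero = (\<lambda>p. \<zero>\<^bsub>obj F p\<^esub>), add = (\<lambda>x y p. x p \<oplus>\<^bsub>obj F p\<^esub> y p),
      smult = (\<lambda>r x p. r \<odot>\<^bsub>obj F p\<^esub> x p)\<rparr>"

definition lim_map :: "('p \<Rightarrow> 'a \<Rightarrow> 'b) \<Rightarrow> ('p \<Rightarrow> 'a) \<Rightarrow> 'p \<Rightarrow> 'b" where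
  "lim_map \<eta> x = (\<lambda>p. \<eta> p (x p))"

text \<open>
  The \<open>n\<close>-th cohomology module of the cochain complex \<open>lim (I 0) \<rightarrow> lim (I 1) \<rightarrow> \<dots>\<close>. When
  \<open>(I, d)\<close> is an injective resolution of \<open>F\<close>, this is the \<open>n\<close>-th right derived functor of the
  inverse limit at \<open>F\<close>, computed with that resolution.
\<close>

definition lim_cohomology ::
    "(nat \<Rightarrow> ('p::order, 'k, 'b) poset_functor) \<Rightarrow> (nat \<Rightarrow> 'p \<Rightarrow> 'b \<Rightarrow> 'b) \<Rightarrow> nat \<Rightarrow>
     ('k, ('p \<Rightarrow> 'b) set) module" where
  "lim_cohomology I d n =
     quotient_module
       ((lim_functor (I n))\<lparr>carrier :=
          a_kernel (lim_functor (I n)) (lim_functor (I (Suc n))) (lim_map (d n))\<rparr>)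
       (case n of 0 \<Rightarrow> {\<zero>\<^bsub>lim_functor (I 0)\<^esub>}
        | Suc m \<Rightarrow> lim_map (d m) ` carrier (lim_functor (I m)))"


section \<open>The functor of a family of module morphisms indexed by the vertices\<close>

definition has_section ::
    "('k, 'c) ring_scheme \<Rightarrow> ('p::order_bot \<Rightarrow> ('k, 'm) module) \<Rightarrow> ('p \<Rightarrow> ('k, 'm) module) \<Rightarrow>
     ('p \<Rightarrow> 'm \<Rightarrow> 'm) \<Rightarrow> bool" where
  "has_section R M N a \<longleftrightarrow>
     (\<exists>s. \<forall>v\<in>vertices. s v \<in> module_hom R (N v) (M v) \<and>
        (\<forall>x\<in>carrier (N v). a v (s v x) = x))"

definition tensor_factor ::
    "('p::order_bot \<Rightarrow> ('k, 'm) module) \<Rightarrow> ('p \<Rightarrow> ('k, 'm) module) \<Rightarrow> 'p \<Rightarrow> 'p \<Rightarrow> ('k, 'm) module" where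
  "tensor_factor M N p v = (if v \<in> vertices_below p then M v else N v)"

definition tensor_functor ::
    "('k, 'c) ring_scheme \<Rightarrow> ('p::order_bot \<Rightarrow> ('k, 'm) module) \<Rightarrow> ('p \<Rightarrow> ('k, 'm) module) \<Rightarrow>
     ('p \<Rightarrow> 'm \<Rightarrow> 'm) \<Rightarrow> ('p, 'k, (('p \<Rightarrow> 'm) \<Rightarrow> 'k) set) poset_functor" where
  "tensor_functor R M N a =
     \<lparr>obj = (\<lambda>p. tensor_product R vertices (tensor_factor M N p)),
      mor = (\<lambda>p q. tensor_map R vertices (tensor_factor M N q) (tensor_factor M N p)
               (\<lambda>v. if v \<in> vertices_below q - vertices_below p then a v else (\<lambda>x. x)))\<rparr>"

end

theory Submission
  imports Defs
begin

text \<open>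
  Let the lower sets of the poset be the open sets of a topology. A contravariant functor on the
  poset is then a sheaf, whose value at \<open>p\<close> is the module of sections over the smallest open
  neighbourhood \<open>{..p}\<close> of \<open>p\<close>, its inverse limit is the module of global sections, and the derived
  functors of the inverse limit are sheaf cohomology. The theorem holds because the tensor functor
  is a flasque sheaf (\<open>tensor_functor_flasque\<close>), and flasque sheaves have no cohomology in positive
  degrees.

  The second fact follows the usual pattern. An injective sheaf is flasque (\<open>injective_flasque\<close>).
  In a short exact sequence whose kernel is flasque, sections of the quotient lift
  (\<open>lift_section\<close>), and hence the quotient is flasque if the middle term is
  (\<open>flasque_quotient\<close>). So all kernels in an injective resolution of a flasque sheaf are flasque,
  and every global cocycle of positive degree lifts to a cochain of which it is the coboundary
  (\<open>lim_cohomology_trivial\<close>).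

  For the first fact, let \<open>q\<close> and \<open>q'\<close> be below \<open>p\<close>. Lower saturation gives a lower bound \<open>w\<close> of
  \<open>q\<close> and \<open>q'\<close> whose vertices are the common vertices of \<open>q\<close> and \<open>q'\<close>. The right inverses of the
  maps \<open>a v\<close> induce right inverses of all restriction maps of the tensor functor, and by the
  choice of \<open>w\<close>, to extend from \<open>q'\<close> to \<open>p\<close> and restrict to \<open>q\<close> is the same as to restrict to \<open>w\<close> and extend to \<open>q\<close>
  (\<open>tensor_functor_base_change\<close>). This is what is needed to glue a compatible family on the
  elements below \<open>p\<close> to an element at \<open>p\<close>, by successive corrections
  (\<open>flasque_of_split_restrictions\<close>).
\<close>

section \<open>Sections and flasqueness\<close>

text \<open>
  The compatible families over \<open>L\<close>. The values of a section outside \<open>L\<close> are arbitrary, so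
  equality of sections is only meaningful on \<open>L\<close>. \<open>Z\<close> is a family of sets and not a functor, so
  that kernels and images of natural transformations can be treated in place, with the
  restrictions \<open>\<rho>\<close> of the functor that contains them.
\<close>

definition sections ::
    "('p::order \<Rightarrow> 'b set) \<Rightarrow> ('p \<Rightarrow> 'p \<Rightarrow> 'b \<Rightarrow> 'b) \<Rightarrow> 'p set \<Rightarrow> ('p \<Rightarrow> 'b) set" where
  "sections Z \<rho> L =
     {x. (\<forall>q\<in>L. x q \<in> Z q) \<and> (\<forall>q\<in>L. \<forall>q'\<in>L. q' \<le> q \<longrightarrow> \<rho> q' q (x q) = x q')}"

text \<open>
  A sheaf is flasque if sections over an open set extend to every larger one. On a finite poset it
  is enough to extend from \<open>{..<p}\<close> to the smallest open set \<open>{..p}\<close> that contains \<open>p\<close>, over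
  which a section is just an element of \<open>Z p\<close>.
\<close>

definition flasque :: "('p::order \<Rightarrow> 'b set) \<Rightarrow> ('p \<Rightarrow> 'p \<Rightarrow> 'b \<Rightarrow> 'b) \<Rightarrow> bool" where
  "flasque Z \<rho> \<longleftrightarrow>
     (\<forall>p. \<forall>x \<in> sections Z \<rho> {..<p}. \<exists>y \<in> Z p. \<forall>q<p. \<rho> q p y = x q)"

lemma sectionsI:
  assumes "\<And>q. q \<in> L \<Longrightarrow> x q \<in> Z q"
    and "\<And>q q'. q \<in> L \<Longrightarrow> q' \<in> L \<Longrightarrow> q' \<le> q \<Longrightarrow> \<rho> q' q (x q) = x q'"
  shows "x \<in> sections Z \<rho> L"
  using assms by (simp add: sections_def)

lemma sectionsD:
  assumes "x \<in> sections Z \<rho> L" and "q \<in> L"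
  shows "x q \<in> Z q" and "q' \<in> L \<Longrightarrow> q' \<le> q \<Longrightarrow> \<rho> q' q (x q) = x q'"
  using assms by (simp_all add: sections_def)

section \<open>Functors and natural transformations\<close>

lemma module_hom_abelian_group_hom:
  assumes "module R M" and "module R N" and "h \<in> module_hom R M N"
  shows "abelian_group_hom M N h"
  using assms
  by (intro abelian_group_homI) (auto simp: module_def module_hom_def hom_def
      intro!: group_hom.intro group_hom_axioms.intro abelian_group.a_group)

lemma is_functor_module: "is_functor R F \<Longrightarrow> module R (obj F p)"
  and is_functor_mor: "is_functor R F \<Longrightarrow> p \<le> q \<Longrightarrow> mor F p q \<in> module_hom R (obj F q) (obj F p)"
  and is_functor_id: "is_functor R F \<Longrightarrow> x \<in> carrier (obj F p) \<Longrightarrow> mor F p p x = x"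
  and is_functor_comp: "is_functor R F \<Longrightarrow> p \<le> q \<Longrightarrow> q \<le> r \<Longrightarrow> x \<in> carrier (obj F r) \<Longrightarrow>
        mor F p q (mor F q r x) = mor F p r x"
  by (simp_all add: is_functor_def)

lemma is_functor_mor_hom:
  "is_functor R F \<Longrightarrow> p \<le> q \<Longrightarrow> abelian_group_hom (obj F q) (obj F p) (mor F p q)"
  by (intro module_hom_abelian_group_hom is_functor_module is_functor_mor)

lemma nat_trans_hom:
  "is_functor R F \<Longrightarrow> is_functor R G \<Longrightarrow> nat_trans R F G \<eta> \<Longrightarrow>
     abelian_group_hom (obj F p) (obj G p) (\<eta> p)"
  by (intro module_hom_abelian_group_hom is_functor_module) (auto simp: nat_trans_def)

lemma nat_trans_natural:
  "nat_trans R F G \<eta> \<Longrightarrow> p \<le> q \<Longrightarrow> x \<in> carrier (obj F q) \<Longrightarrow> \<eta> p (mor F p q x) = mor G p q (\<eta> q x)"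
  by (auto simp: nat_trans_def)

lemma a_kernel_iff: "x \<in> a_kernel G H h \<longleftrightarrow> x \<in> carrier G \<and> h x = \<zero>\<^bsub>H\<^esub>"
  by (simp add: a_kernel_def kernel_def)

section \<open>Exact sequences with a flasque kernel\<close>

text \<open>
  This is the vanishing of the first cohomology of a flasque sheaf: if the kernel of \<open>\<delta>\<close> is
  flasque, then taking sections over \<open>L\<close> preserves the surjection onto the image of \<open>\<delta>\<close>. The lower
  set \<open>L\<close> is built up by adding maximal elements, and a lift at a new element is corrected by a
  section of the kernel to match the lift that has already been found below it.
\<close>

lemma lift_section:
  fixes B :: "('p::order, 'k, 'b) poset_functor" and C :: "('p, 'k, 'u) poset_functor"
  assumes B: "is_functor R B" and C: "is_functor R C" and \<delta>: "nat_trans R B C \<delta>"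
    and flasque: "flasque (\<lambda>p. a_kernel (obj B p) (obj C p) (\<delta> p)) (mor B)"
    and fin: "finite L" and lower: "\<And>p q. p \<in> L \<Longrightarrow> q \<le> p \<Longrightarrow> q \<in> L"
    and c: "c \<in> sections (\<lambda>p. \<delta> p ` carrier (obj B p)) (mor C) L"
  shows "\<exists>b \<in> sections (\<lambda>p. carrier (obj B p)) (mor B) L. \<forall>q\<in>L. \<delta> q (b q) = c q"
  using fin lower c
proof (induction L rule: finite_psubset_induct)
  case (psubset L)
  let ?K = "\<lambda>p. a_kernel (obj B p) (obj C p) (\<delta> p)"
  show ?case
  proof (cases "L = {}")
    case True
    then show ?thesis by (auto simp: sections_def)
  next
    case False
    then obtain p where p: "p \<in> L" and max: "\<And>q. q \<in> L \<Longrightarrow> p \<le> q \<Longrightarrow> q = p"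
      using finite_has_maximal[OF psubset.hyps] by metis
    have below: "q \<in> L - {p}" if "q < p" for q
      using that psubset.prems(1)[OF p] by auto
    have "c \<in> sections (\<lambda>p. \<delta> p ` carrier (obj B p)) (mor C) (L - {p})"
      using psubset.prems(2) by (auto simp: sections_def)
    moreover have "q \<in> L - {p}" if "r \<in> L - {p}" "q \<le> r" for q r
      using that psubset.prems(1) max by blast
    ultimately obtain b where b: "b \<in> sections (\<lambda>p. carrier (obj B p)) (mor B) (L - {p})"
      and bc: "\<And>q. q \<in> L - {p} \<Longrightarrow> \<delta> q (b q) = c q"
      using psubset.IH[of "L - {p}"] p by blast
    obtain b' where b': "b' \<in> carrier (obj B p)" and b'c: "\<delta> p b' = c p"
      using sectionsD(1)[OF psubset.prems(2) p] by auto
    \<comment> \<open>On the elements below \<open>p\<close>, the lift \<open>b'\<close> of \<open>c p\<close> may differ from \<open>b\<close> by a section of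
      the kernel; that section extends to \<open>p\<close>.\<close>
    define k where "k q = mor B q p b' \<ominus>\<^bsub>obj B q\<^esub> b q" for q
    have "k \<in> sections ?K (mor B) {..<p}"
    proof (rule sectionsI)
      fix q assume "q \<in> {..<p}"
      then have q: "q \<le> p" "q < p" "q \<in> L - {p}" "q \<in> L" using below by auto
      interpret r: abelian_group_hom "obj B p" "obj B q" "mor B q p"
        by (rule is_functor_mor_hom[OF B q(1)])
      interpret d: abelian_group_hom "obj B q" "obj C q" "\<delta> q"
        by (rule nat_trans_hom[OF B C \<delta>])
      have bq: "b q \<in> carrier (obj B q)" by (rule sectionsD(1)[OF b q(3)])
      have "\<delta> q (mor B q p b') = c q"
        using nat_trans_natural[OF \<delta> q(1) b'] sectionsD(2)[OF psubset.prems(2) p q(4,1)] b'c by simp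
      then have "\<delta> q (k q) = c q \<ominus>\<^bsub>obj C q\<^esub> c q"
        unfolding k_def a_minus_def using b' bq bc[OF q(3)] by simp
      moreover have "c q \<in> carrier (obj C q)" using bc[OF q(3)] bq d.hom_closed by metis
      ultimately show "k q \<in> ?K q"
        using b' bq by (simp add: a_kernel_iff k_def a_minus_def d.H.r_neg)
    next
      fix q q' assume "q \<in> {..<p}" "q' \<in> {..<p}" and le: "q' \<le> q"
      then have q: "q \<le> p" "q \<in> L - {p}" and q': "q' \<in> L - {p}" using below by auto
      interpret r: abelian_group_hom "obj B p" "obj B q" "mor B q p"
        by (rule is_functor_mor_hom[OF B q(1)])
      interpret r': abelian_group_hom "obj B q" "obj B q'" "mor B q' q"
        by (rule is_functor_mor_hom[OF B le])
      show "mor B q' q (k q) = k q'"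
        unfolding k_def a_minus_def
        using b' sectionsD(1)[OF b q(2)] sectionsD(2)[OF b q(2) q' le] is_functor_comp[OF B le q(1) b']
        by simp
    qed
    then obtain y where y: "y \<in> ?K p" and yk: "\<And>q. q < p \<Longrightarrow> mor B q p y = k q"
      using flasque unfolding flasque_def by blast
    have yB: "y \<in> carrier (obj B p)" and y0: "\<delta> p y = \<zero>\<^bsub>obj C p\<^esub>"
      using y by (simp_all add: a_kernel_iff)
    interpret d: abelian_group_hom "obj B p" "obj C p" "\<delta> p"
      by (rule nat_trans_hom[OF B C \<delta>])
    define b\<^sub>p where "b\<^sub>p = b' \<ominus>\<^bsub>obj B p\<^esub> y"
    have bp: "b\<^sub>p \<in> carrier (obj B p)" and bpc: "\<delta> p b\<^sub>p = c p"
      using b' yB y0 b'c d.hom_closed[OF b'] by (simp_all add: b\<^sub>p_def a_minus_def)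
    have bpb: "mor B q p b\<^sub>p = b q" if "q < p" for q
    proof -
      interpret r: abelian_group_hom "obj B p" "obj B q" "mor B q p"
        using that by (intro is_functor_mor_hom[OF B]) simp
      have "b q \<in> carrier (obj B q)" by (rule sectionsD(1)[OF b below[OF that]])
      then show ?thesis
        unfolding b\<^sub>p_def a_minus_def using b' yB yk[OF that]
        by (simp add: k_def a_minus_def r.H.minus_add r.H.r_neg1 r.H.r_neg flip: r.H.a_assoc)
    qed
    have "b(p := b\<^sub>p) \<in> sections (\<lambda>p. carrier (obj B p)) (mor B) L"
    proof (rule sectionsI)
      show "(b(p := b\<^sub>p)) q \<in> carrier (obj B q)" if "q \<in> L" for q
        using that bp sectionsD(1)[OF b, of q] by auto
      show "mor B q' q ((b(p := b\<^sub>p)) q) = (b(p := b\<^sub>p)) q'" if "q \<in> L" "q' \<in> L" "q' \<le> q" for q q'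
        using that bp bpb is_functor_id[OF B bp] sectionsD(2)[OF b, of q q'] max[of q]
        by (auto simp: less_le)
    qed
    moreover have "\<forall>q\<in>L. \<delta> q ((b(p := b\<^sub>p)) q) = c q"
      using bc bpc by simp
    ultimately show ?thesis by blast
  qed
qed

text \<open>
  A section of the image over \<open>{..<p}\<close> is lifted to \<open>B\<close>, extended to \<open>p\<close> there, and mapped back.
\<close>

lemma flasque_quotient:
  fixes B :: "('p::{finite,order}, 'k, 'b) poset_functor"
  assumes B: "is_functor R B" and C: "is_functor R C" and \<delta>: "nat_trans R B C \<delta>"
    and kernel: "flasque (\<lambda>p. a_kernel (obj B p) (obj C p) (\<delta> p)) (mor B)"
    and total: "flasque (\<lambda>p. carrier (obj B p)) (mor B)"
  shows "flasque (\<lambda>p. \<delta> p ` carrier (obj B p)) (mor C)"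
  unfolding flasque_def
proof (intro allI ballI)
  fix p c assume c: "c \<in> sections (\<lambda>p. \<delta> p ` carrier (obj B p)) (mor C) {..<p}"
  obtain b where b: "b \<in> sections (\<lambda>p. carrier (obj B p)) (mor B) {..<p}"
    and bc: "\<forall>q\<in>{..<p}. \<delta> q (b q) = c q"
    using lift_section[OF B C \<delta> kernel _ _ c] by (auto dest: le_less_trans)
  then obtain y where y: "y \<in> carrier (obj B p)" "\<And>q. q < p \<Longrightarrow> mor B q p y = b q"
    using total unfolding flasque_def by blast
  have "mor C q p (\<delta> p y) = c q" if "q < p" for q
    using nat_trans_natural[OF \<delta>, of q p y] y bc that by simp
  then show "\<exists>z \<in> \<delta> p ` carrier (obj B p). \<forall>q<p. mor C q p z = c q"
    using y(1) by blast
qed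

text \<open>
  Flasqueness is invariant under isomorphism: since the components of \<open>\<eta>\<close> are injective,
  compatibility of a family can be tested after applying them.
\<close>

lemma flasque_embed:
  assumes \<eta>: "nat_trans R F G \<eta>" and inj: "\<And>p. inj_on (\<eta> p) (carrier (obj F p))"
    and closed: "\<And>p q x. p \<le> q \<Longrightarrow> x \<in> carrier (obj F q) \<Longrightarrow> mor F p q x \<in> carrier (obj F p)"
    and flasque: "flasque (\<lambda>p. carrier (obj F p)) (mor F)"
  shows "flasque (\<lambda>p. \<eta> p ` carrier (obj F p)) (mor G)"
  unfolding flasque_def
proof (intro allI ballI)
  fix p z assume z: "z \<in> sections (\<lambda>p. \<eta> p ` carrier (obj F p)) (mor G) {..<p}"
  define x where "x q = inv_into (carrier (obj F q)) (\<eta> q) (z q)" for q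
  have x: "x q \<in> carrier (obj F q)" "\<eta> q (x q) = z q" if "q < p" for q
    using sectionsD(1)[OF z, of q] that
    by (auto simp: x_def inv_into_into f_inv_into_f)
  have "x \<in> sections (\<lambda>p. carrier (obj F p)) (mor F) {..<p}"
  proof (rule sectionsI)
    fix q q' assume q: "q \<in> {..<p}" "q' \<in> {..<p}" "q' \<le> q"
    have "\<eta> q' (mor F q' q (x q)) = \<eta> q' (x q')"
      using q x sectionsD(2)[OF z q] nat_trans_natural[OF \<eta> q(3)] by simp
    then show "mor F q' q (x q) = x q'"
      using q x closed[OF q(3)] by (intro inj_onD[OF inj[of q']]) auto
  qed (use x in auto)
  then obtain y where y: "y \<in> carrier (obj F p)" "\<And>q. q < p \<Longrightarrow> mor F q p y = x q"
    using flasque unfolding flasque_def by blast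
  have "mor G q p (\<eta> p y) = z q" if "q < p" for q
    using nat_trans_natural[OF \<eta>, of q p y] y x that by simp
  then show "\<exists>u \<in> \<eta> p ` carrier (obj F p). \<forall>q<p. mor G q p u = z q"
    using y(1) by blast
qed

section \<open>Injective functors are flasque\<close>

text \<open>
  A copy of \<open>R\<close> as a module over itself, whose elements are the constant sequences: the functors
  against which injectivity is tested have values in modules of sequences.
\<close>

definition const_module :: "('k, 'c) ring_scheme \<Rightarrow> ('k, nat \<Rightarrow> 'k) module" where
  "const_module R = \<lparr>carrier = (\<lambda>r _. r) ` carrier R, mult = undefined, one = undefined,
     zero = (\<lambda>_. \<zero>\<^bsub>R\<^esub>), add = (\<lambda>f g n. f n \<oplus>\<^bsub>R\<^esub> g n), smult = (\<lambda>r f n. r \<otimes>\<^bsub>R\<^esub> f n)\<rparr>"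

text \<open>
  The constant functor on a lower set \<open>L\<close>, extended by zero. Since restrictions go downwards, these
  are functors, and \<open>constant_on R L\<close> is a subfunctor of \<open>constant_on R L'\<close> for \<open>L \<subseteq> L'\<close>. It
  represents the sections over \<open>L\<close>.
\<close>

definition constant_on :: "('k, 'c) ring_scheme \<Rightarrow> 'p set \<Rightarrow> ('p::order, 'k, nat \<Rightarrow> 'k) poset_functor" where
  "constant_on R L = \<lparr>obj = (\<lambda>p. if p \<in> L then const_module R
                                  else const_module R\<lparr>carrier := {\<lambda>_. \<zero>\<^bsub>R\<^esub>}\<rparr>),
     mor = (\<lambda>p q x. x)\<rparr>"

lemma module_const_module: "cring R \<Longrightarrow> module R (const_module R)"
proof -
  assume "cring R"
  then interpret cring R .
  show ?thesis
  proof (intro moduleI abelian_groupI)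
    fix x assume "x \<in> carrier (const_module R)"
    then obtain r where "r \<in> carrier R" "x = (\<lambda>_. r)" by (auto simp: const_module_def)
    then show "\<exists>y\<in>carrier (const_module R). y \<oplus>\<^bsub>const_module R\<^esub> x = \<zero>\<^bsub>const_module R\<^esub>"
      by (intro bexI[of _ "\<lambda>_. \<ominus>\<^bsub>R\<^esub> r"]) (auto simp: const_module_def l_neg)
  qed (auto simp: const_module_def is_cring a_ac m_assoc l_distr r_distr)
qed

lemma is_functor_constant_on:
  assumes "cring R" and lower: "\<And>p q. p \<in> L \<Longrightarrow> q \<le> p \<Longrightarrow> q \<in> L"
  shows "is_functor R (constant_on R L)"
proof -
  interpret c: module R "const_module R" by (rule module_const_module[OF assms(1)])
  have z: "(\<lambda>_. \<zero>\<^bsub>R\<^esub>) = \<zero>\<^bsub>const_module R\<^esub>" by (simp add: const_module_def)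
  have "submodule {\<lambda>_. \<zero>\<^bsub>R\<^esub>} R (const_module R)"
    unfolding z by (intro c.submoduleI) (auto simp: c.smult_r_null)
  then have "module R (const_module R\<lparr>carrier := {\<lambda>_. \<zero>\<^bsub>R\<^esub>}\<rparr>)"
    by (rule submodule.submodule_is_module) (rule c.module_axioms)
  then show ?thesis
    using c.module_axioms lower c.zero_closed
    by (auto simp: is_functor_def constant_on_def module_hom_def z)
qed

text \<open>
  Sections of \<open>I\<close> over a lower set \<open>L\<close> are the same as natural transformations from
  \<open>constant_on R L\<close> to \<open>I\<close>. So to extend a section from \<open>{..<p}\<close> to \<open>p\<close> is to extend a natural
  transformation along the inclusion of \<open>constant_on R {..<p}\<close> in \<open>constant_on R {..p}\<close>; the
  value at \<open>p\<close> is the image of the unit.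
\<close>

lemma injective_flasque:
  fixes I :: "('p::order, 'k, 'b) poset_functor"
  assumes cring: "cring R" and inj: "injective_functor R I"
  shows "flasque (\<lambda>p. carrier (obj I p)) (mor I)"
  unfolding flasque_def
proof (intro allI ballI)
  fix p x assume x: "x \<in> sections (\<lambda>p. carrier (obj I p)) (mor I) {..<p}"
  let ?A = "constant_on R {..<p}" and ?B = "constant_on R {..p}"
  have I: "is_functor R I" using inj by (simp add: injective_functor_def)
  interpret cring R by (rule cring)
  have A: "is_functor R ?A" and B: "is_functor R ?B"
    by (auto intro!: is_functor_constant_on[OF cring] dest: le_less_trans)
  have i: "nat_trans R ?A ?B (\<lambda>_ u. u)"
    by (auto simp: nat_trans_def module_hom_def constant_on_def const_module_def)
  define f where "f q u = (if q < p then u (0::nat) \<odot>\<^bsub>obj I q\<^esub> x q else \<zero>\<^bsub>obj I q\<^esub>)" for q u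
  have f: "nat_trans R ?A I f"
    unfolding nat_trans_def
  proof (intro conjI allI impI ballI)
    fix q
    interpret m: module R "obj I q" by (rule is_functor_module[OF I])
    show "f q \<in> module_hom R (obj ?A q) (obj I q)"
      using sectionsD(1)[OF x, of q]
      by (auto simp: module_hom_def f_def constant_on_def const_module_def
          m.smult_l_distr m.smult_assoc1)
  next
    fix q' q u assume le: "q' \<le> q" and u: "u \<in> carrier (obj ?A q)"
    interpret m: module R "obj I q" by (rule is_functor_module[OF I])
    interpret m': module R "obj I q'" by (rule is_functor_module[OF I])
    interpret r: abelian_group_hom "obj I q" "obj I q'" "mor I q' q"
      by (rule is_functor_mor_hom[OF I le])
    show "f q' (mor ?A q' q u) = mor I q' q (f q u)"
    proof (cases "q < p")
      case True
      then have "q' < p" using le by simp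
      have "u 0 \<in> carrier R" using u True by (auto simp: constant_on_def const_module_def)
      then show ?thesis
        using True \<open>q' < p\<close> le sectionsD[OF x, of q] is_functor_mor[OF I le]
        by (simp add: f_def constant_on_def module_hom_def)
    next
      case False
      then have "u = (\<lambda>_. \<zero>\<^bsub>R\<^esub>)" using u by (simp add: constant_on_def)
      then show ?thesis
        using False sectionsD(1)[OF x, of q'] by (simp add: f_def constant_on_def)
    qed
  qed
  have "\<forall>q. inj_on (\<lambda>u. u) (carrier (obj ?A q))" by simp
  then obtain g where g: "nat_trans R ?B I g"
    and gf: "\<And>q u. u \<in> carrier (obj ?A q) \<Longrightarrow> g q u = f q u"
    using inj A B i f unfolding injective_functor_def by blast
  let ?one = "\<lambda>_::nat. \<one>\<^bsub>R\<^esub>"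
  have one: "?one \<in> carrier (obj ?B p)" by (auto simp: constant_on_def const_module_def)
  have "g p ?one \<in> carrier (obj I p)"
    using g one by (auto simp: nat_trans_def module_hom_def)
  moreover have "mor I q p (g p ?one) = x q" if "q < p" for q
  proof -
    interpret m: module R "obj I q" by (rule is_functor_module[OF I])
    have "mor I q p (g p ?one) = g q ?one"
      using nat_trans_natural[OF g _ one, of q] that by (simp add: constant_on_def)
    also have "\<dots> = f q ?one"
      using that by (intro gf) (auto simp: constant_on_def const_module_def)
    also have "\<dots> = x q" using that sectionsD(1)[OF x, of q] by (simp add: f_def)
    finally show ?thesis .
  qed
  ultimately show "\<exists>y\<in>carrier (obj I p). \<forall>q<p. mor I q p y = x q" by blast
qed

section \<open>Submodules and quotient modules\<close>

lemma submodule_generated_least: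
  "submodule H R M \<Longrightarrow> S \<subseteq> H \<Longrightarrow> submodule_generated R M S \<subseteq> H"
  by (auto simp: submodule_generated_def)

lemma submodule_generated_incl: "S \<subseteq> submodule_generated R M S"
  by (auto simp: submodule_generated_def)

lemma submodule_submodule_generated:
  assumes "module R M" and S: "S \<subseteq> carrier M"
  shows "submodule (submodule_generated R M S) R M"
proof -
  interpret module R M by (rule assms(1))
  show ?thesis
  proof (rule submoduleI)
    show "submodule_generated R M S \<subseteq> carrier M"
      by (rule submodule_generated_least[OF carrier_is_submodule S])
  next
    show "\<zero>\<^bsub>M\<^esub> \<in> submodule_generated R M S"
      unfolding submodule_generated_def
      by (auto dest!: submodule.axioms(1) subgroup.one_closed)
  qed (auto simp: submodule_generated_def intro: submoduleE)
qed

lemma submodule_preimage: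
  assumes M: "module R M" and N: "module R N" and \<phi>: "\<phi> \<in> module_hom R M N"
    and H: "submodule H R N"
  shows "submodule {x \<in> carrier M. \<phi> x \<in> H} R M"
proof -
  interpret M: module R M by (rule M)
  interpret N: module R N by (rule N)
  interpret abelian_group_hom M N \<phi> by (rule module_hom_abelian_group_hom[OF M N \<phi>])
  note E = N.submoduleE[OF H]
  show ?thesis
  proof (rule M.submoduleI)
    show "\<zero>\<^bsub>M\<^esub> \<in> {x \<in> carrier M. \<phi> x \<in> H}"
      using subgroup.one_closed[OF submodule.axioms(1)[OF H]] by simp
  qed (use E \<phi> in \<open>auto simp: module_hom_def\<close>)
qed

lemma submodule_abelian_subgroup:
  assumes "module R M" and "submodule H R M"
  shows "abelian_subgroup H M"
  using assms module.axioms(2)[OF assms(1)]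
  by (auto intro!: abelian_subgroupI3 additive_subgroupI submodule.axioms(1))

lemma quotient_module_simps:
  "carrier (quotient_module M H) = a_rcosets\<^bsub>M\<^esub> H"
  "zero (quotient_module M H) = H"
  "add (quotient_module M H) = set_add M"
  by (simp_all add: quotient_module_def)

lemma carrier_quotient_module: "carrier (quotient_module M H) = (\<lambda>x. H +>\<^bsub>M\<^esub> x) ` carrier M"
  by (auto simp: quotient_module_simps A_RCOSETS_def')

lemma abelian_group_quotient_module:
  assumes "abelian_subgroup H M"
  shows "abelian_group (quotient_module M H)"
proof -
  interpret abelian_subgroup H M by (rule assms)
  interpret Q: comm_group "M A_Mod H" by (rule a_factorgroup_is_comm_group)
  have [simp]: "carrier (M A_Mod H) = carrier (quotient_module M H)"
    "mult (M A_Mod H) = add (quotient_module M H)" "one (M A_Mod H) = zero (quotient_module M H)"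
    by (simp_all add: A_FactGroup_def' quotient_module_simps)
  show ?thesis
    using Q.m_closed Q.one_closed Q.m_assoc Q.m_comm Q.l_one Q.l_inv_ex
    by (intro abelian_groupI) simp_all
qed

text \<open>
  The map between quotient modules that is induced by a homomorphism \<open>\<phi>\<close> to \<open>N\<close>. When \<open>\<phi>\<close> maps
  the submodule divided out in its source into \<open>K\<close>, all cosets in the union are equal.
\<close>

definition induced_map :: "('k, 'b) module \<Rightarrow> 'b set \<Rightarrow> ('a \<Rightarrow> 'b) \<Rightarrow> 'a set \<Rightarrow> 'b set" where
  "induced_map N K \<phi> X = (\<Union>x\<in>X. K +>\<^bsub>N\<^esub> \<phi> x)"

lemma induced_map_coset:
  assumes M: "module R M" and N: "module R N" and \<phi>: "\<phi> \<in> module_hom R M N"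
    and H: "submodule H R M" and K: "submodule K R N" and HK: "\<phi> ` H \<subseteq> K"
    and x: "x \<in> carrier M"
  shows "induced_map N K \<phi> (H +>\<^bsub>M\<^esub> x) = K +>\<^bsub>N\<^esub> \<phi> x"
proof -
  interpret H: abelian_subgroup H M by (rule submodule_abelian_subgroup[OF M H])
  interpret K: abelian_subgroup K N by (rule submodule_abelian_subgroup[OF N K])
  interpret abelian_group_hom M N \<phi> by (rule module_hom_abelian_group_hom[OF M N \<phi>])
  have "K +>\<^bsub>N\<^esub> \<phi> y = K +>\<^bsub>N\<^esub> \<phi> x" if y: "y \<in> H +>\<^bsub>M\<^esub> x" for y
  proof -
    obtain h where h: "h \<in> H" "y = h \<oplus>\<^bsub>M\<^esub> x" using y by (auto simp: a_r_coset_def')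
    have "\<phi> y = \<phi> h \<oplus>\<^bsub>N\<^esub> \<phi> x" using h x H.a_subset by auto
    then have "\<phi> y \<in> K +>\<^bsub>N\<^esub> \<phi> x" using h HK by (auto simp: a_r_coset_def')
    then show ?thesis using K.a_repr_independence' x by simp
  qed
  moreover have "x \<in> H +>\<^bsub>M\<^esub> x" using H.a_rcos_self x by simp
  ultimately show ?thesis unfolding induced_map_def by blast
qed

lemma induced_map_hom:
  assumes M: "module R M" and N: "module R N" and \<phi>: "\<phi> \<in> module_hom R M N"
    and H: "submodule H R M" and K: "submodule K R N" and HK: "\<phi> ` H \<subseteq> K"
  shows "abelian_group_hom (quotient_module M H) (quotient_module N K) (induced_map N K \<phi>)"
proof -
  interpret H: abelian_subgroup H M by (rule submodule_abelian_subgroup[OF M H])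
  interpret K: abelian_subgroup K N by (rule submodule_abelian_subgroup[OF N K])
  interpret abelian_group_hom M N \<phi> by (rule module_hom_abelian_group_hom[OF M N \<phi>])
  note [simp] = induced_map_coset[OF assms]
  show ?thesis
  proof (intro abelian_group_homI group_hom.intro group_hom_axioms.intro homI)
    show "abelian_group (quotient_module M H)"
      by (rule abelian_group_quotient_module[OF H.is_abelian_subgroup])
    show "abelian_group (quotient_module N K)"
      by (rule abelian_group_quotient_module[OF K.is_abelian_subgroup])
    then show "group (add_monoid (quotient_module N K))"
      by (rule abelian_group.a_group)
    show "group (add_monoid (quotient_module M H))"
      by (rule abelian_group.a_group[OF abelian_group_quotient_module[OF H.is_abelian_subgroup]])
  next
    fix X assume "X \<in> carrier (add_monoid (quotient_module M H))"
    then show "induced_map N K \<phi> X \<in> carrier (add_monoid (quotient_module N K))"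
      by (auto simp: carrier_quotient_module)
  next
    fix X Y
    assume "X \<in> carrier (add_monoid (quotient_module M H))"
      and "Y \<in> carrier (add_monoid (quotient_module M H))"
    then obtain x y where "x \<in> carrier M" "y \<in> carrier M" "X = H +>\<^bsub>M\<^esub> x" "Y = H +>\<^bsub>M\<^esub> y"
      by (auto simp: carrier_quotient_module)
    then show "induced_map N K \<phi> (X \<otimes>\<^bsub>add_monoid (quotient_module M H)\<^esub> Y) =
        induced_map N K \<phi> X \<otimes>\<^bsub>add_monoid (quotient_module N K)\<^esub> induced_map N K \<phi> Y"
      by (simp add: quotient_module_simps H.a_rcos_sum K.a_rcos_sum)
  qed
qed

section \<open>Free modules\<close>

lemma free_module_simps:
  "carrier (free_module R X) =
     {f. f \<in> X \<rightarrow> carrier R \<and> (\<forall>x. x \<notin> X \<longrightarrow> f x = \<zero>\<^bsub>R\<^esub>) \<and> finite {x. f x \<noteq> \<zero>\<^bsub>R\<^esub>}}"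
  "zero (free_module R X) = (\<lambda>x. \<zero>\<^bsub>R\<^esub>)"
  "add (free_module R X) = (\<lambda>f g x. f x \<oplus>\<^bsub>R\<^esub> g x)"
  "smult (free_module R X) = (\<lambda>r f x. r \<otimes>\<^bsub>R\<^esub> f x)"
  by (simp_all add: free_module_def)

context cring
begin

lemma free_module_value: "f \<in> carrier (free_module R X) \<Longrightarrow> f x \<in> carrier R"
  by (cases "x \<in> X") (auto simp: free_module_simps)

lemma module_free_module: "module R (free_module R X)"
proof -
  have add: "(\<lambda>x. f x \<oplus> g x) \<in> carrier (free_module R X)"
    if "f \<in> carrier (free_module R X)" "g \<in> carrier (free_module R X)" for f g
  proof -
    have "finite ({x. f x \<noteq> \<zero>} \<union> {x. g x \<noteq> \<zero>})"
      using that by (simp add: free_module_simps)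
    moreover have "{x. f x \<oplus> g x \<noteq> \<zero>} \<subseteq> {x. f x \<noteq> \<zero>} \<union> {x. g x \<noteq> \<zero>}" by auto
    ultimately have "finite {x. f x \<oplus> g x \<noteq> \<zero>}" by (rule finite_subset[rotated])
    then show ?thesis using that by (auto simp: free_module_simps)
  qed
  have mult: "(\<lambda>x. r \<otimes> f x) \<in> carrier (free_module R X)"
    if "f \<in> carrier (free_module R X)" "r \<in> carrier R" for f r
  proof -
    have "finite {x. f x \<noteq> \<zero>}" using that by (simp add: free_module_simps)
    moreover have "{x. r \<otimes> f x \<noteq> \<zero>} \<subseteq> {x. f x \<noteq> \<zero>}" using that by auto
    ultimately have "finite {x. r \<otimes> f x \<noteq> \<zero>}" by (rule finite_subset[rotated])
    then show ?thesis using that by (auto simp: free_module_simps)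
  qed
  show ?thesis
  proof (intro moduleI abelian_groupI)
    fix f assume f: "f \<in> carrier (free_module R X)"
    have "(\<lambda>x. \<ominus> \<one> \<otimes> f x) \<in> carrier (free_module R X)" by (rule mult[OF f]) simp
    moreover have "(\<lambda>x. \<ominus> \<one> \<otimes> f x \<oplus> f x) = (\<lambda>x. \<zero>)"
      using free_module_value[OF f] by (simp add: l_minus l_neg)
    ultimately show "\<exists>g\<in>carrier (free_module R X). g \<oplus>\<^bsub>free_module R X\<^esub> f = \<zero>\<^bsub>free_module R X\<^esub>"
      unfolding free_module_simps(2,3) by (intro bexI)
  next
    show "\<zero>\<^bsub>free_module R X\<^esub> \<in> carrier (free_module R X)" by (simp add: free_module_simps)
  qed (auto simp: free_module_simps(2-) free_module_value add mult is_cring a_ac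
      m_assoc l_distr r_distr)
qed

lemma free_basis_closed: "c \<in> X \<Longrightarrow> free_basis R c \<in> carrier (free_module R X)"
  by (auto simp: free_module_simps free_basis_def)

lemma free_module_induct [consumes 1, case_names zero add]:
  assumes x: "x \<in> carrier (free_module R X)"
    and zero: "P \<zero>\<^bsub>free_module R X\<^esub>"
    and add: "\<And>y r c. y \<in> carrier (free_module R X) \<Longrightarrow> P y \<Longrightarrow> r \<in> carrier R \<Longrightarrow> c \<in> X \<Longrightarrow>
      P (y \<oplus>\<^bsub>free_module R X\<^esub> r \<odot>\<^bsub>free_module R X\<^esub> free_basis R c)"
  shows "P x"
proof -
  have "P x" if "finite S" "{c. x c \<noteq> \<zero>} \<subseteq> S" "x \<in> carrier (free_module R X)" for S x
    using that
  proof (induction S arbitrary: x)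
    case empty
    then have "x = \<zero>\<^bsub>free_module R X\<^esub>" by (auto simp: free_module_simps)
    then show ?case using zero by simp
  next
    case (insert c S)
    show ?case
    proof (cases "x c = \<zero>")
      case True
      then show ?thesis using insert by (intro insert.IH) auto
    next
      case False
      have c: "c \<in> X" using False insert.prems(2) by (auto simp: free_module_simps)
      let ?y = "x(c := \<zero>)"
      have "finite {d. ?y d \<noteq> \<zero>}"
        by (rule finite_subset[OF _ insert.hyps(1)]) (use insert.prems(1) in auto)
      then have y: "?y \<in> carrier (free_module R X)"
        using insert.prems(2) by (auto simp: free_module_simps)
      have "P ?y" by (rule insert.IH[OF _ y]) (use insert.prems(1) in auto)
      moreover have "x = ?y \<oplus>\<^bsub>free_module R X\<^esub> x c \<odot>\<^bsub>free_module R X\<^esub> free_basis R c"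
        using free_module_value[OF insert.prems(2)]
        by (auto simp: free_module_simps free_basis_def)
      ultimately show ?thesis
        using add[OF y _ free_module_value[OF insert.prems(2)] c] by metis
    qed
  qed
  from this[OF _ subset_refl x] show ?thesis using x by (simp add: free_module_simps)
qed

lemma free_module_hom_eqI:
  assumes N: "module R N"
    and \<phi>: "\<phi> \<in> module_hom R (free_module R X) N" and \<psi>: "\<psi> \<in> module_hom R (free_module R X) N"
    and eq: "\<And>c. c \<in> X \<Longrightarrow> \<phi> (free_basis R c) = \<psi> (free_basis R c)"
    and x: "x \<in> carrier (free_module R X)"
  shows "\<phi> x = \<psi> x"
  using x
proof (induction rule: free_module_induct)
  case zero
  show ?case
    using abelian_group_hom.hom_zero[OF module_hom_abelian_group_hom[OF module_free_module N \<phi>]]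
      abelian_group_hom.hom_zero[OF module_hom_abelian_group_hom[OF module_free_module N \<psi>]] by simp
next
  case (add y r c)
  interpret F: module R "free_module R X" by (rule module_free_module)
  show ?case
    using add \<phi> \<psi> eq[of c] free_basis_closed[of c] by (simp add: module_hom_def)
qed

text \<open>
  With a summation range that does not depend on the support of \<open>x\<close>, linearity of \<open>free_map\<close> is
  linearity of finite sums.
\<close>

lemma free_map_eq_finsum:
  assumes x: "x \<in> carrier (free_module R X)" and S: "finite S" "S \<subseteq> X" "{c. x c \<noteq> \<zero>} \<subseteq> S"
  shows "free_map R X f x d = finsum R x {c \<in> S. f c = d}"
  unfolding free_map_def
  using S free_module_value[OF x]
  by (intro add.finprod_mono_neutral_cong_left) auto

lemma free_map_closed:
  assumes f: "f \<in> X \<rightarrow> Y" and x: "x \<in> carrier (free_module R X)"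
  shows "free_map R X f x \<in> carrier (free_module R Y)"
proof -
  let ?S = "{c. x c \<noteq> \<zero>}"
  have S: "finite ?S" "?S \<subseteq> X" using x by (auto simp: free_module_simps)
  note eq = free_map_eq_finsum[OF x S subset_refl]
  have closed: "free_map R X f x d \<in> carrier R" for d
    unfolding eq using free_module_value[OF x] by (intro finsum_closed) auto
  have supp: "free_map R X f x d = \<zero>" if "d \<notin> f ` ?S" for d
  proof -
    have "{c \<in> ?S. f c = d} = {}" using that by auto
    then show ?thesis unfolding eq by (simp only: finsum_empty)
  qed
  have "finite {d. free_map R X f x d \<noteq> \<zero>}"
    by (rule finite_subset[of _ "f ` ?S"]) (use supp S in auto)
  moreover have "free_map R X f x d = \<zero>" if "d \<notin> Y" for d
    using that f S by (intro supp) auto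
  ultimately show ?thesis using closed by (auto simp: free_module_simps)
qed

lemma free_map_hom:
  assumes f: "f \<in> X \<rightarrow> Y"
  shows "free_map R X f \<in> module_hom R (free_module R X) (free_module R Y)"
proof -
  interpret F: module R "free_module R X" by (rule module_free_module)
  have supp: "finite {c. x c \<noteq> \<zero>}" "{c. x c \<noteq> \<zero>} \<subseteq> X" if "x \<in> carrier (free_module R X)" for x
    using that by (auto simp: free_module_simps)
  have "free_map R X f (x \<oplus>\<^bsub>free_module R X\<^esub> y) d = free_map R X f x d \<oplus> free_map R X f y d"
    if x: "x \<in> carrier (free_module R X)" and y: "y \<in> carrier (free_module R X)" for x y d
  proof -
    let ?S = "{c. x c \<noteq> \<zero>} \<union> {c. y c \<noteq> \<zero>}"
    have S: "finite ?S" "?S \<subseteq> X" using supp[OF x] supp[OF y] by auto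
    have "free_map R X f (x \<oplus>\<^bsub>free_module R X\<^esub> y) d =
        finsum R (x \<oplus>\<^bsub>free_module R X\<^esub> y) {c \<in> ?S. f c = d}"
      using S F.add.m_closed[OF x y] by (intro free_map_eq_finsum) (auto simp: free_module_simps(3))
    also have "\<dots> = finsum R x {c \<in> ?S. f c = d} \<oplus> finsum R y {c \<in> ?S. f c = d}"
      unfolding free_module_simps(3)
      using free_module_value[OF x] free_module_value[OF y] by (intro finsum_addf) auto
    also have "\<dots> = free_map R X f x d \<oplus> free_map R X f y d"
      using S by (simp only: free_map_eq_finsum[OF x S] free_map_eq_finsum[OF y S] Un_upper1 Un_upper2)
    finally show ?thesis .
  qed
  moreover have "free_map R X f (r \<odot>\<^bsub>free_module R X\<^esub> x) d = r \<otimes> free_map R X f x d"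
    if x: "x \<in> carrier (free_module R X)" and r: "r \<in> carrier R" for x r d
  proof -
    let ?S = "{c. x c \<noteq> \<zero>}"
    note S = supp[OF x]
    have "free_map R X f (r \<odot>\<^bsub>free_module R X\<^esub> x) d =
        finsum R (r \<odot>\<^bsub>free_module R X\<^esub> x) {c \<in> ?S. f c = d}"
      using S r F.smult_closed[OF r x] by (intro free_map_eq_finsum) (auto simp: free_module_simps(4))
    also have "\<dots> = r \<otimes> finsum R x {c \<in> ?S. f c = d}"
      unfolding free_module_simps(4)
      using free_module_value[OF x] S r by (intro finsum_rdistr[symmetric]) auto
    also have "\<dots> = r \<otimes> free_map R X f x d"
      by (simp only: free_map_eq_finsum[OF x S subset_refl])
    finally show ?thesis .
  qed
  ultimately show ?thesis
    using free_map_closed[OF f] by (auto simp: module_hom_def free_module_simps(3,4) fun_eq_iff)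
qed

lemma free_map_basis:
  assumes c: "c \<in> X"
  shows "free_map R X f (free_basis R c) = free_basis R (f c)"
proof
  fix d
  have "free_map R X f (free_basis R c) d = finsum R (free_basis R c) {c' \<in> {c}. f c' = d}"
    using c by (intro free_map_eq_finsum free_basis_closed) (auto simp: free_basis_def)
  also have "{c' \<in> {c}. f c' = d} = (if f c = d then {c} else {})" by auto
  also have "finsum R (free_basis R c) \<dots> = free_basis R (f c) d"
    by (auto simp: free_basis_def)
  finally show "free_map R X f (free_basis R c) d = free_basis R (f c) d" .
qed

lemma free_map_comp:
  assumes f: "f \<in> X \<rightarrow> Y" and g: "g \<in> Y \<rightarrow> Z" and h: "\<And>c. c \<in> X \<Longrightarrow> g (f c) = h c"
    and x: "x \<in> carrier (free_module R X)"
  shows "free_map R Y g (free_map R X f x) = free_map R X h x"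
proof (rule free_module_hom_eqI[OF module_free_module[of Z] _ _ _ x,
      where \<phi> = "\<lambda>x. free_map R Y g (free_map R X f x)"])
  show "(\<lambda>x. free_map R Y g (free_map R X f x)) \<in> module_hom R (free_module R X) (free_module R Z)"
    using free_map_hom[OF f] free_map_hom[OF g] by (auto simp: module_hom_def Pi_iff)
  show "free_map R X h \<in> module_hom R (free_module R X) (free_module R Z)"
    using f g h by (intro free_map_hom) (simp flip: h add: Pi_iff)
  show "free_map R Y g (free_map R X f (free_basis R c)) = free_map R X h (free_basis R c)"
    if "c \<in> X" for c
    using that f h by (simp add: free_map_basis funcset_mem[OF f])
qed

lemma free_map_ident:
  assumes h: "\<And>c. c \<in> X \<Longrightarrow> h c = c" and x: "x \<in> carrier (free_module R X)"
  shows "free_map R X h x = x"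
proof (rule free_module_hom_eqI[OF module_free_module[of X] _ _ _ x, where \<psi> = "\<lambda>x. x"])
  show "free_map R X h \<in> module_hom R (free_module R X) (free_module R X)"
    using h by (intro free_map_hom) auto
  show "(\<lambda>x. x) \<in> module_hom R (free_module R X) (free_module R X)"
    by (simp add: module_hom_def)
qed (simp add: free_map_basis h)

end

section \<open>Functoriality of tensor products\<close>

text \<open>The generators of the submodule \<open>tensor_relations R V C\<close>.\<close>

definition tensor_relators ::
    "('k, 'c) ring_scheme \<Rightarrow> 'v set \<Rightarrow> ('v \<Rightarrow> ('k, 'm) module) \<Rightarrow> (('v \<Rightarrow> 'm) \<Rightarrow> 'k) set" where
  "tensor_relators R V C =
     (let F = free_module R (tuples V C); b = free_basis R in
        {b (c(v := x \<oplus>\<^bsub>C v\<^esub> y)) \<ominus>\<^bsub>F\<^esub> (b (c(v := x)) \<oplus>\<^bsub>F\<^esub> b (c(v := y))) | c v x y.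
            c \<in> tuples V C \<and> v \<in> V \<and> x \<in> carrier (C v) \<and> y \<in> carrier (C v)} \<union>
        {b (c(v := r \<odot>\<^bsub>C v\<^esub> x)) \<ominus>\<^bsub>F\<^esub> (r \<odot>\<^bsub>F\<^esub> b (c(v := x))) | c v r x.
            c \<in> tuples V C \<and> v \<in> V \<and> r \<in> carrier R \<and> x \<in> carrier (C v)})"

lemma tensor_relations_eq:
  "tensor_relations R V C =
     submodule_generated R (free_module R (tuples V C)) (tensor_relators R V C)"
  by (simp add: tensor_relations_def tensor_relators_def Let_def)

lemma tensor_relator_add:
  "\<lbrakk>c \<in> tuples V C; v \<in> V; x \<in> carrier (C v); y \<in> carrier (C v)\<rbrakk> \<Longrightarrow>
     free_basis R (c(v := x \<oplus>\<^bsub>C v\<^esub> y)) \<ominus>\<^bsub>free_module R (tuples V C)\<^esub>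
       (free_basis R (c(v := x)) \<oplus>\<^bsub>free_module R (tuples V C)\<^esub> free_basis R (c(v := y)))
     \<in> tensor_relators R V C"
  unfolding tensor_relators_def Let_def by blast

lemma tensor_relator_smult:
  "\<lbrakk>c \<in> tuples V C; v \<in> V; r \<in> carrier R; x \<in> carrier (C v)\<rbrakk> \<Longrightarrow>
     free_basis R (c(v := r \<odot>\<^bsub>C v\<^esub> x)) \<ominus>\<^bsub>free_module R (tuples V C)\<^esub>
       (r \<odot>\<^bsub>free_module R (tuples V C)\<^esub> free_basis R (c(v := x)))
     \<in> tensor_relators R V C"
  unfolding tensor_relators_def Let_def by blast

lemma tensor_relators_cases [consumes 1, case_names add smult]:
  assumes "t \<in> tensor_relators R V C"
  obtains (add) c v x y where "c \<in> tuples V C" "v \<in> V" "x \<in> carrier (C v)" "y \<in> carrier (C v)"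
      "t = free_basis R (c(v := x \<oplus>\<^bsub>C v\<^esub> y)) \<ominus>\<^bsub>free_module R (tuples V C)\<^esub>
        (free_basis R (c(v := x)) \<oplus>\<^bsub>free_module R (tuples V C)\<^esub> free_basis R (c(v := y)))"
    | (smult) c v r x where "c \<in> tuples V C" "v \<in> V" "r \<in> carrier R" "x \<in> carrier (C v)"
      "t = free_basis R (c(v := r \<odot>\<^bsub>C v\<^esub> x)) \<ominus>\<^bsub>free_module R (tuples V C)\<^esub>
        (r \<odot>\<^bsub>free_module R (tuples V C)\<^esub> free_basis R (c(v := x)))"
  using assms unfolding tensor_relators_def Let_def by blast

lemma tuples_update: "c \<in> tuples V C \<Longrightarrow> v \<in> V \<Longrightarrow> x \<in> carrier (C v) \<Longrightarrow> c(v := x) \<in> tuples V C"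
  by (auto simp: tuples_def PiE_iff extensional_def)

lemma tuples_map:
  assumes "\<And>v. v \<in> V \<Longrightarrow> f v \<in> module_hom R (C v) (D v)"
  shows "(\<lambda>c. \<lambda>v\<in>V. f v (c v)) \<in> tuples V C \<rightarrow> tuples V D"
  using assms by (fastforce simp: tuples_def module_hom_def PiE_iff)

lemma restrict_map_update:
  "v \<in> V \<Longrightarrow> (\<lambda>w\<in>V. f w ((c(v := x)) w)) = (\<lambda>w\<in>V. f w (c w))(v := f v x)"
  by auto

context cring
begin

lemma submodule_tensor_relations:
  assumes C: "\<And>v. v \<in> V \<Longrightarrow> module R (C v)"
  shows "submodule (tensor_relations R V C) R (free_module R (tuples V C))"
proof -
  interpret F: module R "free_module R (tuples V C)" by (rule module_free_module)
  have "t \<in> carrier (free_module R (tuples V C))" if "t \<in> tensor_relators R V C" for t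
    using that
  proof (cases rule: tensor_relators_cases)
    case (add c v x y)
    interpret v: module R "C v" by (rule C[OF add(2)])
    show ?thesis using add by (simp add: tuples_update free_basis_closed)
  next
    case (smult c v r x)
    interpret v: module R "C v" by (rule C[OF smult(2)])
    show ?thesis using smult by (simp add: tuples_update free_basis_closed)
  qed
  then show ?thesis
    unfolding tensor_relations_eq
    by (intro submodule_submodule_generated module_free_module) auto
qed

text \<open>
  Linear maps in all the factors turn a generator of the relations into the generator of the same
  kind at the image tuple, so tensor maps are well defined on cosets.
\<close>

lemma free_map_tensor_relations:
  assumes C: "\<And>v. v \<in> V \<Longrightarrow> module R (C v)" and D: "\<And>v. v \<in> V \<Longrightarrow> module R (D v)"
    and f: "\<And>v. v \<in> V \<Longrightarrow> f v \<in> module_hom R (C v) (D v)"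
  shows "free_map R (tuples V C) (\<lambda>c. \<lambda>v\<in>V. f v (c v)) ` tensor_relations R V C
    \<subseteq> tensor_relations R V D"
proof -
  let ?\<phi> = "free_map R (tuples V C) (\<lambda>c. \<lambda>v\<in>V. f v (c v))"
  have \<phi>: "?\<phi> \<in> module_hom R (free_module R (tuples V C)) (free_module R (tuples V D))"
    by (intro free_map_hom tuples_map[where R = R] f)
  interpret F: module R "free_module R (tuples V C)" by (rule module_free_module)
  interpret G: module R "free_module R (tuples V D)" by (rule module_free_module)
  interpret h: abelian_group_hom "free_module R (tuples V C)" "free_module R (tuples V D)" ?\<phi>
    by (rule module_hom_abelian_group_hom[OF module_free_module module_free_module \<phi>])
  have basis: "?\<phi> (free_basis R (c(v := x))) = free_basis R ((\<lambda>w\<in>V. f w (c w))(v := f v x))"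
    if "c \<in> tuples V C" "v \<in> V" "x \<in> carrier (C v)" for c v x
    by (simp only: free_map_basis[of _ "tuples V C", OF tuples_update[OF that]]
        restrict_map_update[OF that(2)])
  have closed: "free_basis R (c(v := x)) \<in> carrier (free_module R (tuples V C))"
    if "c \<in> tuples V C" "v \<in> V" "x \<in> carrier (C v)" for c v x
    by (intro free_basis_closed tuples_update that)
  have tuple: "(\<lambda>w\<in>V. f w (c w)) \<in> tuples V D" if "c \<in> tuples V C" for c
    using tuples_map[where R = R and f = f, OF f] that by blast
  have "t \<in> carrier (free_module R (tuples V C)) \<and> ?\<phi> t \<in> tensor_relators R V D"
    if "t \<in> tensor_relators R V C" for t
    using that
  proof (cases rule: tensor_relators_cases)
    case (add c v x y)
    interpret v: module R "C v" by (rule C[OF add(2)])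
    have fv: "f v x \<in> carrier (D v)" "f v y \<in> carrier (D v)" "f v (x \<oplus>\<^bsub>C v\<^esub> y) = f v x \<oplus>\<^bsub>D v\<^esub> f v y"
      using f[OF add(2)] add(3,4) by (auto simp: module_hom_def)
    note cl = closed[OF add(1,2)] and bs = basis[OF add(1,2)] and xy = add(3,4) v.add.m_closed[OF add(3,4)]
    have "?\<phi> t = free_basis R ((\<lambda>w\<in>V. f w (c w))(v := f v x \<oplus>\<^bsub>D v\<^esub> f v y))
        \<ominus>\<^bsub>free_module R (tuples V D)\<^esub>
          (free_basis R ((\<lambda>w\<in>V. f w (c w))(v := f v x)) \<oplus>\<^bsub>free_module R (tuples V D)\<^esub>
           free_basis R ((\<lambda>w\<in>V. f w (c w))(v := f v y)))"
      unfolding add(5) a_minus_def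
      by (simp only: h.hom_add h.hom_a_inv F.add.m_closed F.add.inv_closed cl bs xy fv)
    then show ?thesis
      using tensor_relator_add[where R = R and C = D, OF tuple[OF add(1)] add(2) fv(1,2)]
        cl[OF xy(1)] cl[OF xy(2)] cl[OF xy(3)] by (simp only: add(5) F.minus_closed F.add.m_closed simp_thms)
  next
    case (smult c v r x)
    interpret v: module R "C v" by (rule C[OF smult(2)])
    have fv: "f v x \<in> carrier (D v)" "f v (r \<odot>\<^bsub>C v\<^esub> x) = r \<odot>\<^bsub>D v\<^esub> f v x"
      using f[OF smult(2)] smult(3,4) by (auto simp: module_hom_def)
    note cl = closed[OF smult(1,2)] and bs = basis[OF smult(1,2)]
      and rx = smult(4) v.smult_closed[OF smult(3,4)]
    have "?\<phi> (r \<odot>\<^bsub>free_module R (tuples V C)\<^esub> free_basis R (c(v := x))) =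
        r \<odot>\<^bsub>free_module R (tuples V D)\<^esub> ?\<phi> (free_basis R (c(v := x)))"
      using \<phi> smult(3) cl[OF rx(1)] unfolding module_hom_def by blast
    then have "?\<phi> t = free_basis R ((\<lambda>w\<in>V. f w (c w))(v := r \<odot>\<^bsub>D v\<^esub> f v x))
        \<ominus>\<^bsub>free_module R (tuples V D)\<^esub>
          (r \<odot>\<^bsub>free_module R (tuples V D)\<^esub> free_basis R ((\<lambda>w\<in>V. f w (c w))(v := f v x)))"
      unfolding smult(5) a_minus_def
      by (simp only: h.hom_add h.hom_a_inv F.smult_closed F.add.inv_closed cl bs rx fv smult(3))
    then show ?thesis
      using tensor_relator_smult[where R = R and C = D, OF tuple[OF smult(1)] smult(2,3) fv(1)]
        cl[OF rx(1)] cl[OF rx(2)]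
      by (simp only: smult(3,5) F.minus_closed F.smult_closed simp_thms)
  qed
  then have "tensor_relators R V C \<subseteq>
      {t \<in> carrier (free_module R (tuples V C)). ?\<phi> t \<in> tensor_relations R V D}"
    unfolding tensor_relations_eq[of R V D]
    by (auto intro: subsetD[OF submodule_generated_incl])
  then have "tensor_relations R V C \<subseteq>
      {t \<in> carrier (free_module R (tuples V C)). ?\<phi> t \<in> tensor_relations R V D}"
    unfolding tensor_relations_eq[of R V C]
    by (intro submodule_generated_least submodule_preimage[where N = "free_module R (tuples V D)"]
        module_free_module \<phi>
        submodule_tensor_relations D)
  then show ?thesis by blast
qed

lemma tensor_map_induced_map:
  "tensor_map R V C D f = induced_map (free_module R (tuples V D)) (tensor_relations R V D)
     (free_map R (tuples V C) (\<lambda>c. \<lambda>v\<in>V. f v (c v)))"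
  by (simp add: tensor_map_def induced_map_def fun_eq_iff)

lemma tensor_map_hom:
  assumes C: "\<And>v. v \<in> V \<Longrightarrow> module R (C v)" and D: "\<And>v. v \<in> V \<Longrightarrow> module R (D v)"
    and f: "\<And>v. v \<in> V \<Longrightarrow> f v \<in> module_hom R (C v) (D v)"
  shows "abelian_group_hom (tensor_product R V C) (tensor_product R V D) (tensor_map R V C D f)"
  unfolding tensor_product_def tensor_map_induced_map
  by (intro induced_map_hom[where R = R] module_free_module free_map_hom tuples_map[where R = R] f
      submodule_tensor_relations free_map_tensor_relations C D)

lemma tensor_map_coset:
  assumes C: "\<And>v. v \<in> V \<Longrightarrow> module R (C v)" and D: "\<And>v. v \<in> V \<Longrightarrow> module R (D v)"
    and f: "\<And>v. v \<in> V \<Longrightarrow> f v \<in> module_hom R (C v) (D v)"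
    and x: "x \<in> carrier (free_module R (tuples V C))"
  shows "tensor_map R V C D f (tensor_relations R V C +>\<^bsub>free_module R (tuples V C)\<^esub> x) =
    tensor_relations R V D +>\<^bsub>free_module R (tuples V D)\<^esub>
      free_map R (tuples V C) (\<lambda>c. \<lambda>v\<in>V. f v (c v)) x"
  unfolding tensor_map_induced_map
  by (intro induced_map_coset[where R = R] module_free_module free_map_hom tuples_map[where R = R] f
      submodule_tensor_relations free_map_tensor_relations C D x)

text \<open>
  Equations between composites of tensor maps are checked factor by factor, on the carriers. The
  composite is expressed by a given family \<open>h\<close>, so that two composites are shown to be equal by
  comparing both with the same \<open>h\<close>.
\<close>

lemma tensor_map_comp:
  assumes C: "\<And>v. v \<in> V \<Longrightarrow> module R (C v)" and D: "\<And>v. v \<in> V \<Longrightarrow> module R (D v)"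
    and E: "\<And>v. v \<in> V \<Longrightarrow> module R (E v)"
    and f: "\<And>v. v \<in> V \<Longrightarrow> f v \<in> module_hom R (C v) (D v)"
    and g: "\<And>v. v \<in> V \<Longrightarrow> g v \<in> module_hom R (D v) (E v)"
    and h: "\<And>v. v \<in> V \<Longrightarrow> h v \<in> module_hom R (C v) (E v)"
    and gf: "\<And>v x. v \<in> V \<Longrightarrow> x \<in> carrier (C v) \<Longrightarrow> g v (f v x) = h v x"
    and X: "X \<in> carrier (tensor_product R V C)"
  shows "tensor_map R V D E g (tensor_map R V C D f X) = tensor_map R V C E h X"
proof -
  obtain x where x: "x \<in> carrier (free_module R (tuples V C))"
    and X: "X = tensor_relations R V C +>\<^bsub>free_module R (tuples V C)\<^esub> x"
    using X by (auto simp: tensor_product_def carrier_quotient_module)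
  let ?f = "\<lambda>c. \<lambda>v\<in>V. f v (c v)" and ?g = "\<lambda>c. \<lambda>v\<in>V. g v (c v)" and ?h = "\<lambda>c. \<lambda>v\<in>V. h v (c v)"
  have f': "?f \<in> tuples V C \<rightarrow> tuples V D" and g': "?g \<in> tuples V D \<rightarrow> tuples V E"
    by (rule tuples_map[OF f] tuples_map[OF g]; assumption)+
  have "?g (?f c) = ?h c" if "c \<in> tuples V C" for c
    using that gf by (auto simp: tuples_def PiE_iff)
  then have "free_map R (tuples V D) ?g (free_map R (tuples V C) ?f x) = free_map R (tuples V C) ?h x"
    by (intro free_map_comp[OF f' g'] x)
  then show ?thesis
    unfolding X
    using tensor_map_coset[of V C D f x, OF C D f x] tensor_map_coset[of V C E h x, OF C E h x]
      tensor_map_coset[of V D E g, OF D E g free_map_closed[OF f' x]]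
    by simp
qed

lemma tensor_map_ident:
  assumes C: "\<And>v. v \<in> V \<Longrightarrow> module R (C v)"
    and f: "\<And>v x. v \<in> V \<Longrightarrow> x \<in> carrier (C v) \<Longrightarrow> f v x = x"
    and X: "X \<in> carrier (tensor_product R V C)"
  shows "tensor_map R V C C f X = X"
proof -
  obtain x where x: "x \<in> carrier (free_module R (tuples V C))"
    and X: "X = tensor_relations R V C +>\<^bsub>free_module R (tuples V C)\<^esub> x"
    using X by (auto simp: tensor_product_def carrier_quotient_module)
  have hom: "f v \<in> module_hom R (C v) (C v)" if "v \<in> V" for v
  proof -
    interpret v: module R "C v" by (rule C[OF that])
    show ?thesis by (auto simp: module_hom_def f[OF that])
  qed
  have "(\<lambda>v\<in>V. f v (c v)) = c" if "c \<in> tuples V C" for c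
    using that f by (auto simp: tuples_def PiE_iff extensional_def fun_eq_iff)
  then show ?thesis
    unfolding X using tensor_map_coset[of V C C f x, OF C C hom x] free_map_ident[OF _ x] by simp
qed

end

section \<open>Flasqueness of the tensor functor\<close>

text \<open>
  A Chinese remainder argument. Suppose that the restrictions have right inverses \<open>s\<close> which
  commute with restriction in the squares \<open>w \<le> q, q' \<le> p\<close>, for a suitable \<open>w\<close> depending on \<open>q\<close> and \<open>q'\<close>.
  Given a compatible family \<open>x\<close> below \<open>p\<close> and a \<open>y\<close> that restricts to \<open>x q\<close> for all \<open>q\<close> in a set
  \<open>Q\<close>, let \<open>u\<close> be the difference of \<open>x q'\<close> and the restriction of \<open>y\<close> to \<open>q'\<close>. Then
  \<open>y + s q' p u\<close> restricts correctly to \<open>q'\<close>, and it still does so for \<open>q \<in> Q\<close>, because the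
  correction restricts on \<open>q\<close> to the image of the restriction of \<open>u\<close> to \<open>w\<close>, which is zero.
\<close>

lemma flasque_of_split_restrictions:
  fixes F :: "('p::{finite,order}, 'k, 'b) poset_functor"
  assumes r: "\<And>p q. p \<le> q \<Longrightarrow> abelian_group_hom (obj F q) (obj F p) (mor F p q)"
    and s: "\<And>p q. p \<le> q \<Longrightarrow> abelian_group_hom (obj F p) (obj F q) (s p q)"
    and comp: "\<And>p q t x. p \<le> q \<Longrightarrow> q \<le> t \<Longrightarrow> x \<in> carrier (obj F t) \<Longrightarrow>
      mor F p q (mor F q t x) = mor F p t x"
    and split: "\<And>p q x. p \<le> q \<Longrightarrow> x \<in> carrier (obj F p) \<Longrightarrow> mor F p q (s p q x) = x"
    and base_change: "\<And>p q q'. q \<le> p \<Longrightarrow> q' \<le> p \<Longrightarrow> \<exists>w. w \<le> q \<and> w \<le> q' \<and>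
      (\<forall>x\<in>carrier (obj F q'). mor F q p (s q' p x) = s w q (mor F w q' x))"
  shows "flasque (\<lambda>p. carrier (obj F p)) (mor F)"
  unfolding flasque_def
proof (intro allI ballI)
  fix p x assume x: "x \<in> sections (\<lambda>p. carrier (obj F p)) (mor F) {..<p}"
  have "\<exists>y\<in>carrier (obj F p). \<forall>q\<in>Q. mor F q p y = x q" if "finite Q" "Q \<subseteq> {..<p}" for Q
    using that
  proof (induction Q)
    case empty
    interpret id: abelian_group_hom "obj F p" "obj F p" "mor F p p" by (rule r) simp
    show ?case by auto
  next
    case (insert q' Q)
    then obtain y where y: "y \<in> carrier (obj F p)" and yx: "\<And>q. q \<in> Q \<Longrightarrow> mor F q p y = x q"
      by auto
    have q': "q' \<le> p" "q' \<in> {..<p}" using insert.prems by auto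
    interpret r': abelian_group_hom "obj F p" "obj F q'" "mor F q' p" by (rule r[OF q'(1)])
    interpret s': abelian_group_hom "obj F q'" "obj F p" "s q' p" by (rule s[OF q'(1)])
    define u where "u = x q' \<ominus>\<^bsub>obj F q'\<^esub> mor F q' p y"
    have xq': "x q' \<in> carrier (obj F q')" by (rule sectionsD(1)[OF x q'(2)])
    have u: "u \<in> carrier (obj F q')" using xq' y by (simp add: u_def)
    have "mor F q' p (y \<oplus>\<^bsub>obj F p\<^esub> s q' p u) = x q'"
      using y u split[OF q'(1) u] xq'
      by (simp add: u_def a_minus_def r'.H.a_comm r'.H.r_neg1 r'.H.a_lcomm r'.H.r_neg)
    moreover have "mor F q p (y \<oplus>\<^bsub>obj F p\<^esub> s q' p u) = x q" if q: "q \<in> Q" for q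
    proof -
      have le: "q \<le> p" "q \<in> {..<p}" using q insert.prems by auto
      obtain w where w: "w \<le> q" "w \<le> q'"
        and bc: "\<And>x. x \<in> carrier (obj F q') \<Longrightarrow> mor F q p (s q' p x) = s w q (mor F w q' x)"
        using base_change[OF le(1) q'(1)] by blast
      have wp: "w \<in> {..<p}" using w(1) le(2) by auto
      interpret rq: abelian_group_hom "obj F p" "obj F q" "mor F q p" by (rule r[OF le(1)])
      interpret rw: abelian_group_hom "obj F q'" "obj F w" "mor F w q'" by (rule r[OF w(2)])
      interpret sw: abelian_group_hom "obj F w" "obj F q" "s w q" by (rule s[OF w(1)])
      \<comment> \<open>The error \<open>u\<close> at \<open>q'\<close> vanishes on \<open>w\<close>, because \<open>y\<close> is already correct at \<open>q \<ge> w\<close>.\<close>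
      have "mor F w q' (mor F q' p y) = mor F w q (mor F q p y)"
        using comp[OF w(2) q'(1) y] comp[OF w(1) le(1) y] by simp
      also have "\<dots> = x w" using yx[OF q] sectionsD(2)[OF x le(2) wp w(1)] by simp
      finally have "mor F w q' u = \<zero>\<^bsub>obj F w\<^esub>"
        using xq' y sectionsD(1)[OF x wp] sectionsD(2)[OF x q'(2) wp w(2)]
        by (simp add: u_def a_minus_def rw.H.r_neg)
      then have "mor F q p (s q' p u) = \<zero>\<^bsub>obj F q\<^esub>" using bc[OF u] by simp
      then show ?thesis using y u yx[OF q] sectionsD(1)[OF x le(2)] by simp
    qed
    ultimately show ?case
      using y u by (intro bexI[of _ "y \<oplus>\<^bsub>obj F p\<^esub> s q' p u"]) auto
  qed
  from this[of "{..<p}"] show "\<exists>y\<in>carrier (obj F p). \<forall>q<p. mor F q p y = x q" by auto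
qed

lemma vertices_below_mono: "p \<le> q \<Longrightarrow> vertices_below p \<subseteq> vertices_below q"
  by (auto simp: vertices_below_def intro: order_trans)

text \<open>
  Any two elements below \<open>p\<close> have a minimal upper bound, by finiteness, so that lower saturation
  applies to them.
\<close>

lemma lower_saturated_meet:
  fixes p q q' :: "'p::{finite,order_bot}"
  assumes "lower_saturated TYPE('p)" and "q \<le> p" and "q' \<le> p"
  shows "\<exists>w. w \<le> q \<and> w \<le> q' \<and> vertices_below w = vertices_below q \<inter> vertices_below q'"
proof -
  obtain z where "z \<in> {z. q \<le> z \<and> q' \<le> z}"
    and "\<And>w. w \<in> {z. q \<le> z \<and> q' \<le> z} \<Longrightarrow> w \<le> z \<Longrightarrow> z = w"
    using finite_has_minimal[of "{z. q \<le> z \<and> q' \<le> z}"] assms(2,3) by auto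
  then have "z \<in> minimal_upper_bounds q q'"
    by (auto simp: minimal_upper_bounds_def)
  then obtain w where "w \<in> maximal_lower_bounds q q'"
    and "vertices_below w = vertices_below q \<inter> vertices_below q'"
    using assms(1) unfolding lower_saturated_def by blast
  then show ?thesis by (auto simp: maximal_lower_bounds_def)
qed

lemma module_hom_ident: "(\<lambda>x. x) \<in> module_hom R M M"
  by (simp add: module_hom_def)

context
  fixes R :: "('k, 'c) ring_scheme"
    and M N :: "'p::{finite, order_bot} \<Rightarrow> ('k, 'm) module"
    and a s :: "'p \<Rightarrow> 'm \<Rightarrow> 'm"
  assumes cring: "cring R"
    and M: "\<And>v. v \<in> vertices \<Longrightarrow> module R (M v)"
    and N: "\<And>v. v \<in> vertices \<Longrightarrow> module R (N v)"
    and a: "\<And>v. v \<in> vertices \<Longrightarrow> a v \<in> module_hom R (M v) (N v)"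
    and s: "\<And>v. v \<in> vertices \<Longrightarrow> s v \<in> module_hom R (N v) (M v)"
    and as: "\<And>v x. v \<in> vertices \<Longrightarrow> x \<in> carrier (N v) \<Longrightarrow> a v (s v x) = x"
begin

text \<open>
  The restriction from \<open>q\<close> to \<open>p \<le> q\<close> applies \<open>a\<close> in the factors at the vertices that lie below
  \<open>q\<close> but not below \<open>p\<close>; it is split by applying \<open>s\<close> in the same factors.
\<close>

definition tensor_section where
  "tensor_section p q = tensor_map R vertices (tensor_factor M N p) (tensor_factor M N q)
     (\<lambda>v. if v \<in> vertices_below q - vertices_below p then s v else (\<lambda>x. x))"

lemma module_tensor_factor: "v \<in> vertices \<Longrightarrow> module R (tensor_factor M N p v)"
  by (simp add: tensor_factor_def M N)

lemma restriction_factor_hom: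
  assumes "p \<le> q" and "v \<in> vertices"
  shows "(if v \<in> vertices_below q - vertices_below p then a v else (\<lambda>x. x))
    \<in> module_hom R (tensor_factor M N q v) (tensor_factor M N p v)"
  using assms vertices_below_mono[of p q] by (auto simp: tensor_factor_def a module_hom_ident)

lemma section_factor_hom:
  assumes "p \<le> q" and "v \<in> vertices"
  shows "(if v \<in> vertices_below q - vertices_below p then s v else (\<lambda>x. x))
    \<in> module_hom R (tensor_factor M N p v) (tensor_factor M N q v)"
  using assms vertices_below_mono[of p q] by (auto simp: tensor_factor_def s module_hom_ident)

lemma tensor_functor_mor_hom:
  "p \<le> q \<Longrightarrow> abelian_group_hom (obj (tensor_functor R M N a) q) (obj (tensor_functor R M N a) p)
     (mor (tensor_functor R M N a) p q)"
  unfolding tensor_functor_def poset_functor.simps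
  by (intro cring.tensor_map_hom cring module_tensor_factor restriction_factor_hom)

lemma tensor_section_hom:
  "p \<le> q \<Longrightarrow> abelian_group_hom (obj (tensor_functor R M N a) p) (obj (tensor_functor R M N a) q)
     (tensor_section p q)"
  unfolding tensor_functor_def poset_functor.simps tensor_section_def
  by (intro cring.tensor_map_hom cring module_tensor_factor section_factor_hom)

lemma tensor_functor_comp:
  assumes "p \<le> q" and "q \<le> t" and "x \<in> carrier (obj (tensor_functor R M N a) t)"
  shows "mor (tensor_functor R M N a) p q (mor (tensor_functor R M N a) q t x) =
    mor (tensor_functor R M N a) p t x"
  using assms vertices_below_mono[OF assms(1)] vertices_below_mono[OF assms(2)]
  unfolding tensor_functor_def poset_functor.simps
  by (intro cring.tensor_map_comp cring module_tensor_factor restriction_factor_hom) auto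

lemma tensor_functor_split:
  assumes pq: "p \<le> q" and x: "x \<in> carrier (obj (tensor_functor R M N a) p)"
  shows "mor (tensor_functor R M N a) p q (tensor_section p q x) = x"
proof -
  have "mor (tensor_functor R M N a) p q (tensor_section p q x) =
      tensor_map R vertices (tensor_factor M N p) (tensor_factor M N p) (\<lambda>v x. x) x"
    using x as unfolding tensor_functor_def poset_functor.simps tensor_section_def
    by (intro cring.tensor_map_comp cring module_tensor_factor restriction_factor_hom
        section_factor_hom module_hom_ident pq) (auto simp: tensor_factor_def)
  also have "\<dots> = x"
    using x unfolding tensor_functor_def poset_functor.simps
    by (intro cring.tensor_map_ident cring module_tensor_factor) auto
  finally show ?thesis .
qed

text \<open>
  Going from \<open>q'\<close> to \<open>q\<close> through \<open>p\<close> applies \<open>s\<close> and then \<open>a\<close> at the vertices of \<open>p\<close> that are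
  below neither of them, and this is the identity. Going through \<open>w\<close> would apply \<open>a\<close> and then \<open>s\<close>,
  which is not the identity, at the vertices of both \<open>q\<close> and \<open>q'\<close> that are not below \<open>w\<close>; the
  condition on the vertices of \<open>w\<close> says that there are none. At the other vertices both ways agree.
\<close>

lemma tensor_functor_base_change:
  assumes q: "q \<le> p" "q' \<le> p" and w: "w \<le> q" "w \<le> q'"
    and V: "vertices_below w = vertices_below q \<inter> vertices_below q'"
    and x: "x \<in> carrier (obj (tensor_functor R M N a) q')"
  shows "mor (tensor_functor R M N a) q p (tensor_section q' p x) =
    tensor_section w q (mor (tensor_functor R M N a) w q' x)"
proof -
  let ?V = vertices_below
  let ?h = "\<lambda>v. if v \<in> ?V q' - ?V q then a v else if v \<in> ?V q - ?V q' then s v else (\<lambda>x. x)"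
  let ?t = "tensor_map R vertices (tensor_factor M N q') (tensor_factor M N q) ?h x"
  have h: "?h v \<in> module_hom R (tensor_factor M N q' v) (tensor_factor M N q v)"
    if "v \<in> vertices" for v
    using that by (auto simp: tensor_factor_def a s module_hom_ident)
  have Vq: "?V q \<subseteq> ?V p" "?V q' \<subseteq> ?V p" using q by (simp_all add: vertices_below_mono)
  have "mor (tensor_functor R M N a) q p (tensor_section q' p x) = ?t"
    using x as Vq h unfolding tensor_functor_def poset_functor.simps tensor_section_def
    by (intro cring.tensor_map_comp cring module_tensor_factor restriction_factor_hom
        section_factor_hom q h) (auto simp: tensor_factor_def)
  moreover have "tensor_section w q (mor (tensor_functor R M N a) w q' x) = ?t"
    using x V h unfolding tensor_functor_def poset_functor.simps tensor_section_def
    by (intro cring.tensor_map_comp cring module_tensor_factor restriction_factor_hom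
        section_factor_hom w h) auto
  ultimately show ?thesis by simp
qed

lemma tensor_functor_flasque:
  assumes "lower_saturated TYPE('p)"
  shows "flasque (\<lambda>p. carrier (obj (tensor_functor R M N a) p)) (mor (tensor_functor R M N a))"
proof (rule flasque_of_split_restrictions[where s = tensor_section])
  fix p q q' :: 'p assume q: "q \<le> p" "q' \<le> p"
  obtain w where "w \<le> q" "w \<le> q'" "vertices_below w = vertices_below q \<inter> vertices_below q'"
    using lower_saturated_meet[OF assms q] by blast
  then show "\<exists>w. w \<le> q \<and> w \<le> q' \<and> (\<forall>x\<in>carrier (obj (tensor_functor R M N a) q').
      mor (tensor_functor R M N a) q p (tensor_section q' p x) =
      tensor_section w q (mor (tensor_functor R M N a) w q' x))"
    using tensor_functor_base_change[OF q] by blast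
qed (fact tensor_functor_mor_hom tensor_section_hom tensor_functor_comp tensor_functor_split)+

end

section \<open>Cohomology of the inverse limit\<close>

lemma abelian_group_lim_functor:
  assumes F: "is_functor R F"
  shows "abelian_group (lim_functor F)"
proof -
  have grp: "abelian_group (obj F p)" for p
    by (rule module.axioms(2)[OF is_functor_module[OF F]])
  note hom = is_functor_mor_hom[OF F]
  have carrier: "x \<in> carrier (lim_functor F) \<longleftrightarrow>
      (\<forall>p. x p \<in> carrier (obj F p)) \<and> (\<forall>p q. p \<le> q \<longrightarrow> mor F p q (x q) = x p)" for x
    by (simp add: lim_functor_def)
  have ops: "zero (lim_functor F) = (\<lambda>p. \<zero>\<^bsub>obj F p\<^esub>)"
    "add (lim_functor F) = (\<lambda>x y p. x p \<oplus>\<^bsub>obj F p\<^esub> y p)"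
    by (simp_all add: lim_functor_def)
  note monoid = abelian_group.axioms(1)[OF grp]
  note [simp] = abelian_monoid.a_assoc[OF monoid] abelian_monoid.a_comm[OF monoid]
    abelian_monoid.a_closed[OF monoid] abelian_monoid.l_zero[OF monoid] abelian_monoid.r_zero[OF monoid]
    abelian_monoid.a_lcomm[OF monoid] abelian_group.r_neg[OF grp]
  show ?thesis
  proof (rule abelian_groupI)
    fix x assume x: "x \<in> carrier (lim_functor F)"
    show "\<exists>y\<in>carrier (lim_functor F). y \<oplus>\<^bsub>lim_functor F\<^esub> x = \<zero>\<^bsub>lim_functor F\<^esub>"
      using x abelian_group_hom.hom_a_inv[OF hom] abelian_group.a_inv_closed[OF grp]
      by (intro bexI[of _ "\<lambda>p. \<ominus>\<^bsub>obj F p\<^esub> x p"]) (auto simp: carrier ops)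
  qed (auto simp: carrier ops abelian_group_hom.hom_add[OF hom] abelian_group_hom.hom_zero[OF hom]
      abelian_monoid.zero_closed[OF monoid])
qed

lemma lim_map_natural:
  assumes "nat_trans R F G \<eta>" and "x \<in> carrier (lim_functor F)" and "p \<le> q"
  shows "mor G p q (lim_map \<eta> x q) = lim_map \<eta> x p"
  using nat_trans_natural[OF assms(1,3), of "x q"] assms(2,3)
  by (simp add: lim_functor_def lim_map_def)

lemma lim_map_hom:
  assumes F: "is_functor R F" and G: "is_functor R G" and \<eta>: "nat_trans R F G \<eta>"
  shows "abelian_group_hom (lim_functor F) (lim_functor G) (lim_map \<eta>)"
proof (intro abelian_group_homI group_hom.intro group_hom_axioms.intro homI
    abelian_group.a_group abelian_group_lim_functor[OF F] abelian_group_lim_functor[OF G])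
  note hom = nat_trans_hom[OF F G \<eta>]
  show "lim_map \<eta> x \<in> carrier (add_monoid (lim_functor G))"
    if "x \<in> carrier (add_monoid (lim_functor F))" for x
  proof -
    have "lim_map \<eta> x p \<in> carrier (obj G p)" for p
      using that abelian_group_hom.hom_closed[OF hom] by (simp add: lim_functor_def lim_map_def)
    then show ?thesis using lim_map_natural[OF \<eta>, of x] that by (simp add: lim_functor_def)
  qed
  show "lim_map \<eta> (x \<otimes>\<^bsub>add_monoid (lim_functor F)\<^esub> y) =
      lim_map \<eta> x \<otimes>\<^bsub>add_monoid (lim_functor G)\<^esub> lim_map \<eta> y"
    if "x \<in> carrier (add_monoid (lim_functor F))" "y \<in> carrier (add_monoid (lim_functor F))" for x y
    using that abelian_group_hom.hom_add[OF hom] by (auto simp: lim_functor_def lim_map_def)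
qed

text \<open>
  The inverse limit of a functor is its module of global sections. A cocycle of degree \<open>Suc m\<close> is
  a global section of the image of \<open>d m\<close>, and by \<open>lift_section\<close> it lifts to a global section of
  \<open>I m\<close>, so it is a coboundary.
\<close>

lemma lim_cohomology_trivial:
  fixes I :: "nat \<Rightarrow> ('p::{finite,order}, 'k, 'u) poset_functor"
  assumes I: "\<And>n. is_functor R (I n)" and d: "\<And>n. nat_trans R (I n) (I (Suc n)) (d n)"
    and exact: "\<And>p. d m p ` carrier (obj (I m) p) =
        a_kernel (obj (I (Suc m)) p) (obj (I (Suc (Suc m))) p) (d (Suc m) p)"
    and flasque: "flasque (\<lambda>p. a_kernel (obj (I m) p) (obj (I (Suc m)) p) (d m p)) (mor (I m))"
  shows "carrier (lim_cohomology I d (Suc m)) = {\<zero>\<^bsub>lim_cohomology I d (Suc m)\<^esub>}"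
proof -
  let ?L = "lim_functor (I (Suc m))"
  define Z where "Z = a_kernel ?L (lim_functor (I (Suc (Suc m)))) (lim_map (d (Suc m)))"
  have Z_iff: "x \<in> Z \<longleftrightarrow> x \<in> sections (\<lambda>p. d m p ` carrier (obj (I m) p)) (mor (I (Suc m))) UNIV" for x
    unfolding exact
    by (auto simp: Z_def a_kernel_iff lim_functor_def lim_map_def sections_def fun_eq_iff)
  interpret Z: additive_subgroup Z ?L
    unfolding Z_def by (rule abelian_group_hom.additive_subgroup_a_kernel[OF lim_map_hom[OF I I d]])
  interpret abelian_group ?L by (rule abelian_group_lim_functor[OF I])
  have image: "lim_map (d m) ` carrier (lim_functor (I m)) = Z"
  proof
    show "lim_map (d m) ` carrier (lim_functor (I m)) \<subseteq> Z"
      unfolding image_subset_iff Z_iff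
    proof (intro ballI sectionsI)
      fix x p assume "x \<in> carrier (lim_functor (I m))"
      then show "lim_map (d m) x p \<in> d m p ` carrier (obj (I m) p)"
        by (simp add: lim_functor_def lim_map_def)
    qed (rule lim_map_natural[OF d])
    show "Z \<subseteq> lim_map (d m) ` carrier (lim_functor (I m))"
    proof
      fix c assume "c \<in> Z"
      then obtain b where b: "b \<in> sections (\<lambda>p. carrier (obj (I m) p)) (mor (I m)) UNIV"
        and "\<forall>q. d m q (b q) = c q"
        using lift_section[OF I I d flasque finite, of UNIV c] by (auto simp: Z_iff)
      then have "c = lim_map (d m) b" by (auto simp: lim_map_def)
      moreover have "b \<in> carrier (lim_functor (I m))"
        using b by (auto simp: sections_def lim_functor_def)
      ultimately show "c \<in> lim_map (d m) ` carrier (lim_functor (I m))" by blast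
    qed
  qed
  have "Z +>\<^bsub>?L\<lparr>carrier := Z\<rparr>\<^esub> x = Z" if "x \<in> Z" for x
    using a_coset_join2[OF _ Z.a_subgroup that] Z.a_subset that by (auto simp: a_r_coset_def')
  moreover have "Z \<noteq> {}" using Z.zero_closed by blast
  ultimately have "a_rcosets\<^bsub>?L\<lparr>carrier := Z\<rparr>\<^esub> Z = {Z}"
    by (auto simp: A_RCOSETS_def')
  then show ?thesis
    unfolding lim_cohomology_def nat.case image quotient_module_simps Z_def[symmetric] .
qed

theorem theorem2:
  fixes R :: "('k, 'c) ring_scheme"
    and M N :: "'p::{finite, order_bot} \<Rightarrow> ('k, 'm) module"
    and a :: "'p \<Rightarrow> 'm \<Rightarrow> 'm"
    and I :: "nat \<Rightarrow> ('p, 'k, 'u) poset_functor"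
    and d :: "nat \<Rightarrow> 'p \<Rightarrow> 'u \<Rightarrow> 'u"
    and e :: "'p \<Rightarrow> (('p \<Rightarrow> 'm) \<Rightarrow> 'k) set \<Rightarrow> 'u"
    and n :: nat
  assumes "cring R"
    and "lower_saturated TYPE('p)"
    and "\<And>v. v \<in> vertices \<Longrightarrow> module R (M v)"
    and "\<And>v. v \<in> vertices \<Longrightarrow> module R (N v)"
    and "\<And>v. v \<in> vertices \<Longrightarrow> a v \<in> module_hom R (M v) (N v)"
    and "has_section R M N a"
    and "injective_resolution R (tensor_functor R M N a) I d e"
    and "n > 0"
  shows "carrier (lim_cohomology I d n) = {\<zero>\<^bsub>lim_cohomology I d n\<^esub>}"
proof -
  let ?T = "tensor_functor R M N a"
  let ?Z = "\<lambda>m p. a_kernel (obj (I m) p) (obj (I (Suc m)) p) (d m p)"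
  obtain s where s: "\<And>v. v \<in> vertices \<Longrightarrow> s v \<in> module_hom R (N v) (M v)"
    "\<And>v x. v \<in> vertices \<Longrightarrow> x \<in> carrier (N v) \<Longrightarrow> a v (s v x) = x"
    using assms(6) unfolding has_section_def by blast
  have injective: "injective_functor R (I m)" and d: "nat_trans R (I m) (I (Suc m)) (d m)"
    and exact: "d m p ` carrier (obj (I m) p) = ?Z (Suc m) p" for m p
    using assms(7) by (simp_all add: injective_resolution_def)
  have e: "nat_trans R ?T (I 0) e" "\<And>p. inj_on (e p) (carrier (obj ?T p))"
    "\<And>p. e p ` carrier (obj ?T p) = ?Z 0 p"
    using assms(7) by (simp_all add: injective_resolution_def)
  have I: "is_functor R (I m)" for m
    using injective by (simp add: injective_functor_def)
  \<comment> \<open>Flasqueness spreads along the resolution: each kernel is the quotient of a flasque functor by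
    the preceding kernel.\<close>
  have "flasque (?Z m) (mor (I m))" for m
  proof (induction m)
    case 0
    have "flasque (\<lambda>p. e p ` carrier (obj ?T p)) (mor (I 0))"
    proof (rule flasque_embed[OF e(1,2)])
      show "flasque (\<lambda>p. carrier (obj ?T p)) (mor ?T)"
        by (rule tensor_functor_flasque[OF assms(1,3-5) s assms(2)])
      show "mor ?T p q x \<in> carrier (obj ?T p)" if "p \<le> q" "x \<in> carrier (obj ?T q)" for p q x
        using abelian_group_hom.hom_closed[OF
            tensor_functor_mor_hom[OF assms(1,3-5) s that(1)] that(2)] .
    qed
    then show ?case by (simp add: e(3))
  next
    case (Suc m)
    then show ?case
      using flasque_quotient[OF I I d Suc injective_flasque[OF assms(1) injective]]
      by (simp add: exact)
  qed
  moreover obtain m where "n = Suc m" using assms(8) gr0_conv_Suc by blast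
  ultimately show ?thesis using lim_cohomology_trivial[where I = I and d = d and m = m, OF I d exact] by simp
qed

end
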